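(* For $l\ge2\max(\underline N_{\mathfrak C},\underline N_\Gamma)$ and $z_1,z_2\in\mathbb C^*$, the Christoffel–Darboux kernels and their Geronimus–Uvarov transformations satisfy the connection formulas $$\overline{L^{(2)}_{\mathfrak C}(z_1)}\,\tilde K^{(1,2),[l]}(\bar z_1,z_2)-L^{(1)}_\Gamma(z_2)K^{[l]}(\bar z_1,z_2)=\Big[\tfrac{\tilde\phi^{(1,2)}_{1,l-2\underline N_{\mathfrak C}}(z_2)}{\tilde H^{(1,2)}_{l-2\underline N_{\mathfrak C}}},\dots,\tfrac{\tilde\phi^{(1,2)}_{1,l+2\underline N_\Gamma-1}(z_2)}{\tilde H^{(1,2)}_{l+2\underline N_\Gamma-1}}\Big]\begin{bmatrix}0&\overline{\mathfrak C^{(1,2)}_{2,l}}\\-\overline{\Gamma^{(1,2)}_{2,l}}&0\end{bmatrix}\begin{bmatrix}\overline{\phi_{2,l-2\underline N_\Gamma}(z_1)}\\\vdots\\\overline{\phi_{2,l+2\underline N_{\mathfrak C}-1}(z_1)}\end{bmatrix},$$ $$L^{(1)}_{\mathfrak C}(z_2)\,\tilde K^{(2,1),[l]}(\bar z_1,z_2)-\overline{L^{(2)}_\Gamma(z_1)}K^{[l]}(\bar z_1,z_2)=\Big[\tfrac{\overline{\tilde\phi^{(2,1)}_{2,l-2\underline N_{\mathfrak C}}(z_1)}}{\tilde H^{(2,1)}_{l-2\underline N_{\mathfrak C}}},\dots,\tfrac{\overline{\tilde\phi^{(2,1)}_{2,l+2\underline N_\Gamma-1}(z_1)}}{\tilde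 H^{(2,1)}_{l+2\underline N_\Gamma-1}}\Big]\begin{bmatrix}0&\mathfrak C^{(2,1)}_{1,l}\\-\Gamma^{(2,1)}_{1,l}&0\end{bmatrix}\begin{bmatrix}\phi_{1,l-2\underline N_\Gamma}(z_2)\\\vdots\\\phi_{1,l+2\underline N_{\mathfrak C}-1}(z_2)\end{bmatrix},$$ where the upper left zero blocks are of size $2\underline N_{\mathfrak C}\times2\underline N_\Gamma$ and the lower right ones of size $2\underline N_\Gamma\times2\underline N_{\mathfrak C}$.
   Context: Conventions: $\mathbb C^*=\mathbb C\setminus\{0\}$; $\dagger$ is conjugate transpose; $\sigma(L)$ is the zero set of $L$ in $\mathbb C^*$; $f^{(l)}=\partial^lf/\partial z^l$. Functionals: $\mathcal F$ is a space of fundamental (test) functions on $\mathbb C^*$ strictly containing $\mathbb C[z,z^{-1}]$, whose continuous linear functionals have a well-defined support (e.g. $\mathcal F=C^\infty(\mathbb C^* )$, functionals being compactly supported distributions). A functional may be evaluated on functions admissible only on a neighbourhood of its support. $u=u_{z_1,\bar z_2}$ is a bivariate linear functional with well-defined support; $\operatorname{supp}_1(u),\operatorname{supp}_2(u)$ are the projections of the support to the $z_1$- and $z_2$-coordinates. Its sesquilinear form is $\langle f(z_1),g(z_2)\rangle_u=\langle u_{z_1,\bar z_2},f(z_1)\otimes\overline{g(z_2)}\rangle$. CMV basis: $\chi=[\chi^{(0)},\chi^{(1)},\dots]^\top$, $\chi^{(2k)}(z)=z^k$, $\chi^{(2k+1)}(z)=z^{-k-1}$. $\Upsilon$ is the semi-infinite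 $0/1$ matrix with nonzero entries $\Upsilon_{2k,2k+2}=1$ ($k\ge0$), $\Upsilon_{1,0}=1$, $\Upsilon_{2k+1,2k-1}=1$ ($k\ge1$); $\Upsilon\chi(z)=z\chi(z)$, $\Upsilon^{-1}=\Upsilon^\top$; for $L(z)=\sum_kL_kz^k$, $L(\Upsilon)=\sum_kL_k\Upsilon^k$. Gram matrix $G=(\langle\chi^{(k)},\chi^{(l)}\rangle_u)_{k,l\ge0}$, assumed quasidefinite (all leading principal minors nonzero), so $G=S_1^{-1}H(S_2^{-1})^\dagger$ with $S_1,S_2$ lower unitriangular and $H=\operatorname{diag}(H_0,H_1,\dots)$ nonsingular. $\phi_1=S_1\chi$, $\phi_2=S_2\chi$, with components $\phi_{1,k},\phi_{2,k}$. Geronimus–Uvarov perturbations: for $a\in\{1,2\}$, $L^{(a)}_\rho(z)=L^{(a)}_{\rho,N^+_\rho}z^{N^+_\rho}+\dots+L^{(a)}_{\rho,-N^-_\rho}z^{-N^-_\rho}$, $\rho\in\{\Gamma,\mathfrak C\}$, $N^\pm_\rho\in\{1,2,\dots\}$, with nonzero extreme coefficients, $\sigma(L^{(1)}_\Gamma)\cap\operatorname{supp}_1(u)=\varnothing$, $\sigma(L^{(2)}_\Gamma)\cap\operatorname{supp}_2(u)=\varnothing$; $\underline N_\rho:=\max(N^+_\rho,N^-_\rho)$. $L^{(a)}_\Gamma$ has distinct zeros $\zeta^{(a)}_i$ with multiplicities $m^{(a)}_i$, $1\le i\le d^{(a)}$; $\xi^{(a)}_{i,l}$ are arbitrary univariate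 linear functionals. The perturbed forms are $$\langle f,g\rangle_{\tilde u^{(1,2)}}=\Big\langle u,\tfrac{f(z_1)}{L^{(1)}_\Gamma(z_1)}\otimes\overline{L^{(2)}_{\mathfrak C}(z_2)g(z_2)}\Big\rangle+\sum_{i=1}^{d^{(1)}}\sum_{l=0}^{m^{(1)}_i-1}\tfrac1{l!}f^{(l)}(\zeta^{(1)}_i)\overline{\langle\xi^{(1)}_{i,l},L^{(2)}_{\mathfrak C}g\rangle},$$ $$\langle f,g\rangle_{\tilde u^{(2,1)}}=\Big\langle u,L^{(1)}_{\mathfrak C}(z_1)f(z_1)\otimes\overline{\tfrac{g(z_2)}{L^{(2)}_\Gamma(z_2)}}\Big\rangle+\sum_{i=1}^{d^{(2)}}\sum_{l=0}^{m^{(2)}_i-1}\tfrac1{l!}\langle\xi^{(2)}_{i,l},L^{(1)}_{\mathfrak C}f\rangle\overline{g^{(l)}(\zeta^{(2)}_i)}.$$ Their Gram matrices $\tilde G^{(1)}$ (of $\tilde u^{(1,2)}$) and $\tilde G^{(2)}$ (of $\tilde u^{(2,1)}$) in the CMV basis are assumed quasidefinite: $\tilde G^{(1)}=(\tilde S^{(1)}_1)^{-1}\tilde H^{(1,2)}(\tilde S^{(1)}_2)^{-\dagger}$, $\tilde G^{(2)}=(\tilde S^{(2)}_1)^{-1}\tilde H^{(2,1)}(\tilde S^{(2)}_2)^{-\dagger}$ (lower unitriangular $\tilde S$'s, diagonal nonsingular $\tilde H$'s with entries $\tilde H^{(1,2)}_k,\tilde H^{(2,1)}_k$); $\tilde\phi^{(1,2)}_j=\tilde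 S^{(1)}_j\chi$, $\tilde\phi^{(2,1)}_j=\tilde S^{(2)}_j\chi$, $j=1,2$. Kernels: $K^{[l]}(\bar z_1,z_2)=\sum_{k=0}^{l-1}\overline{\phi_{2,k}(z_1)}H_k^{-1}\phi_{1,k}(z_2)$; $\tilde K^{(1,2),[l]},\tilde K^{(2,1),[l]}$ are the same sums with $\phi_{j,k},H_k$ replaced by $\tilde\phi^{(1,2)}_{j,k},\tilde H^{(1,2)}_k$, respectively $\tilde\phi^{(2,1)}_{j,k},\tilde H^{(2,1)}_k$. Connectors: $\Omega^{(1,2)}_2=\tilde S^{(1)}_2L^{(2)}_{\mathfrak C}(\Upsilon)S_2^{-1}$, $\Omega^{(2,1)}_1=\tilde S^{(2)}_1L^{(1)}_{\mathfrak C}(\Upsilon)S_1^{-1}$; they are banded, with entries $(p,q)$ vanishing unless $-2\underline N_\Gamma\le q-p\le2\underline N_{\mathfrak C}$. $\Gamma^{(1,2)}_{2,l}$ is the (upper triangular) $2\underline N_\Gamma\times2\underline N_\Gamma$ matrix with entries $(\Omega^{(1,2)}_2)_{l+i,\,l-2\underline N_\Gamma+j}$, $0\le i,j\le2\underline N_\Gamma-1$; $\mathfrak C^{(1,2)}_{2,l}$ is the (lower triangular) $2\underline N_{\mathfrak C}\times2\underline N_{\mathfrak C}$ matrix with entries $(\Omega^{(1,2)}_2)_{l-2\underline N_{\mathfrak C}+i,\,l+j}$, $0\le i,j\le2\underline N_{\mathfrak C}-1$. $\Gamma^{(2,1)}_{1,l},\mathfrak C^{(2,1)}_{1,l}$ are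 defined in the same way from $\Omega^{(2,1)}_1$. *)

theory Defs
  imports
    "HOL-Complex_Analysis.Complex_Analysis"
    "HOL-Library.Poly_Mapping"
    "HOL-Library.Groups_Big_Fun"
    "Jordan_Normal_Form.Matrix"
    "Jordan_Normal_Form.Determinant"
begin

text \<open>The Laurent polynomial ring is the monoid algebra of the integers.\<close>

type_synonym laurent = "int \<Rightarrow>\<^sub>0 complex"

definition laurent_eval :: "laurent \<Rightarrow> complex \<Rightarrow> complex" where
  "laurent_eval L z = (\<Sum>k\<in>Poly_Mapping.keys L. Poly_Mapping.lookup L k * z powi k)"

definition laurent_span :: "laurent \<Rightarrow> nat \<Rightarrow> nat \<Rightarrow> bool" where
  "laurent_span L Np Nm \<longleftrightarrow>
     Poly_Mapping.keys L \<subseteq> {- int Nm .. int Np} \<and>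
     Poly_Mapping.lookup L (int Np) \<noteq> 0 \<and> Poly_Mapping.lookup L (- int Nm) \<noteq> 0"

definition Cstar :: "complex set" where
  "Cstar = - {0}"

definition zero_set :: "laurent \<Rightarrow> complex set" where
  "zero_set L = {z \<in> Cstar. laurent_eval L z = 0}"

definition zeros_with_mult :: "laurent \<Rightarrow> nat \<Rightarrow> (nat \<Rightarrow> complex) \<Rightarrow> (nat \<Rightarrow> nat) \<Rightarrow> bool" where
  "zeros_with_mult L d \<zeta> m \<longleftrightarrow>
     bij_betw \<zeta> {1..d} (zero_set L) \<and>
     (\<forall>i\<in>{1..d}. zorder (laurent_eval L) (\<zeta> i) = int (m i))"

text \<open>Functions on the punctured plane are represented by total functions whose value at \<open>0\<close> is
  irrelevant; hence all function spaces below are closed under changes outside the domain.\<close>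

definition laurent_functions :: "(complex \<Rightarrow> complex) set" where
  "laurent_functions = {f. \<exists>L. \<forall>z\<in>Cstar. f z = laurent_eval L z}"

definition function_space :: "'a set \<Rightarrow> ('a \<Rightarrow> complex) set \<Rightarrow> bool" where
  "function_space X F \<longleftrightarrow>
     (\<lambda>x. 0) \<in> F \<and>
     (\<forall>f\<in>F. \<forall>g\<in>F. (\<lambda>x. f x + g x) \<in> F) \<and>
     (\<forall>c. \<forall>f\<in>F. (\<lambda>x. c * f x) \<in> F) \<and>
     (\<forall>f\<in>F. \<forall>g. (\<forall>x\<in>X. g x = f x) \<longrightarrow> g \<in> F)"

definition linear_functional :: "'a set \<Rightarrow> ('a \<Rightarrow> complex) set \<Rightarrow> (('a \<Rightarrow> complex) \<Rightarrow> complex) \<Rightarrow> bool" where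
  "linear_functional X F u \<longleftrightarrow>
     (\<forall>f\<in>F. \<forall>g\<in>F. u (\<lambda>x. f x + g x) = u f + u g) \<and>
     (\<forall>c. \<forall>f\<in>F. u (\<lambda>x. c * f x) = c * u f) \<and>
     (\<forall>f\<in>F. \<forall>g\<in>F. (\<forall>x\<in>X. f x = g x) \<longrightarrow> u f = u g)"

definition continuous_functionals ::
    "'a set \<Rightarrow> ('a \<Rightarrow> complex) topology \<Rightarrow> (('a \<Rightarrow> complex) \<Rightarrow> complex) set" where
  "continuous_functionals X T =
     {u. linear_functional X (topspace T) u \<and> continuous_map T euclidean u}"

definition fun_support :: "'a::topological_space set \<Rightarrow> ('a \<Rightarrow> complex) \<Rightarrow> 'a set" where
  "fun_support X f = X \<inter> closure {x \<in> X. f x \<noteq> 0}"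

definition vanishes_on ::
    "'a::topological_space set \<Rightarrow> ('a \<Rightarrow> complex) set \<Rightarrow> (('a \<Rightarrow> complex) \<Rightarrow> complex) \<Rightarrow> 'a set \<Rightarrow> bool" where
  "vanishes_on X F u W \<longleftrightarrow> (\<forall>f\<in>F. fun_support X f \<subseteq> W \<longrightarrow> u f = 0)"

definition supp ::
    "'a::topological_space set \<Rightarrow> ('a \<Rightarrow> complex) set \<Rightarrow> (('a \<Rightarrow> complex) \<Rightarrow> complex) \<Rightarrow> 'a set" where
  "supp X F u = X - \<Union>{W. open W \<and> W \<subseteq> X \<and> vanishes_on X F u W}"

text \<open>The support is well defined if there is a largest open set on which the functional vanishes.\<close>

definition has_support ::
    "'a::topological_space set \<Rightarrow> ('a \<Rightarrow> complex) set \<Rightarrow> (('a \<Rightarrow> complex) \<Rightarrow> complex) \<Rightarrow> bool" where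
  "has_support X F u \<longleftrightarrow> vanishes_on X F u (X - supp X F u)"

text \<open>A function \<open>f\<close> is admissible near the support of \<open>u\<close> if it agrees with a test function on a
  neighbourhood of the support; the functional is then evaluated on \<open>f\<close> through any such test
  function, and the result does not depend on the choice when \<open>u\<close> has a well-defined support.\<close>

definition agree_near ::
    "'a::topological_space set \<Rightarrow> ('a \<Rightarrow> complex) set \<Rightarrow> (('a \<Rightarrow> complex) \<Rightarrow> complex)
      \<Rightarrow> ('a \<Rightarrow> complex) \<Rightarrow> ('a \<Rightarrow> complex) \<Rightarrow> bool" where
  "agree_near X F u g f \<longleftrightarrow>
     (\<exists>V. open V \<and> supp X F u \<subseteq> V \<and> (\<forall>x\<in>V \<inter> X. g x = f x))"

definition admissible ::
    "'a::topological_space set \<Rightarrow> ('a \<Rightarrow> complex) set \<Rightarrow> (('a \<Rightarrow> complex) \<Rightarrow> complex)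
      \<Rightarrow> ('a \<Rightarrow> complex) \<Rightarrow> bool" where
  "admissible X F u f \<longleftrightarrow> (\<exists>g\<in>F. agree_near X F u g f)"

definition eval_functional ::
    "'a::topological_space set \<Rightarrow> ('a \<Rightarrow> complex) set \<Rightarrow> (('a \<Rightarrow> complex) \<Rightarrow> complex)
      \<Rightarrow> ('a \<Rightarrow> complex) \<Rightarrow> complex" where
  "eval_functional X F u f = (THE c. \<exists>g\<in>F. agree_near X F u g f \<and> u g = c)"

definition tensor_cnj ::
    "(complex \<Rightarrow> complex) \<Rightarrow> (complex \<Rightarrow> complex) \<Rightarrow> complex \<times> complex \<Rightarrow> complex" where
  "tensor_cnj f g = (\<lambda>(z1, z2). f z1 * cnj (g z2))"

abbreviation Cstar2 :: "(complex \<times> complex) set" where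
  "Cstar2 \<equiv> Cstar \<times> Cstar"

abbreviation supp1 ::
    "(complex \<times> complex \<Rightarrow> complex) topology \<Rightarrow> ((complex \<times> complex \<Rightarrow> complex) \<Rightarrow> complex) \<Rightarrow> complex set" where
  "supp1 T u \<equiv> fst ` supp Cstar2 (topspace T) u"

abbreviation supp2 ::
    "(complex \<times> complex \<Rightarrow> complex) topology \<Rightarrow> ((complex \<times> complex \<Rightarrow> complex) \<Rightarrow> complex) \<Rightarrow> complex set" where
  "supp2 T u \<equiv> snd ` supp Cstar2 (topspace T) u"

text \<open>\<open>T\<^sub>1\<close> and \<open>T\<^sub>2\<close> are the (topologized) spaces of univariate and bivariate fundamental functions,
  for instance the smooth functions on the punctured plane and on its square. The assumptions
  \<open>local_evaluation1\<close> and \<open>local_evaluation2\<close> say that quotients by Laurent polynomials without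
  zeros on the relevant projection of the support are admissible near the support.\<close>

locale fundamental_functions =
  fixes T1 :: "(complex \<Rightarrow> complex) topology"
    and T2 :: "(complex \<times> complex \<Rightarrow> complex) topology"
  assumes function_space1: "function_space Cstar (topspace T1)"
    and function_space2: "function_space Cstar2 (topspace T2)"
    and laurent_strict_subset: "laurent_functions \<subset> topspace T1"
    and tensor_closed:
      "\<lbrakk>f \<in> topspace T1; g \<in> topspace T1\<rbrakk> \<Longrightarrow> tensor_cnj f g \<in> topspace T2"
    and support1: "v \<in> continuous_functionals Cstar T1 \<Longrightarrow> has_support Cstar (topspace T1) v"
    and support2: "u \<in> continuous_functionals Cstar2 T2 \<Longrightarrow> has_support Cstar2 (topspace T2) u"
    and local_evaluation1:
      "\<lbrakk>u \<in> continuous_functionals Cstar2 T2; zero_set L \<inter> supp1 T2 u = {};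
        f \<in> laurent_functions; g \<in> laurent_functions\<rbrakk>
       \<Longrightarrow> admissible Cstar2 (topspace T2) u (tensor_cnj (\<lambda>z. f z / laurent_eval L z) g)"
    and local_evaluation2:
      "\<lbrakk>u \<in> continuous_functionals Cstar2 T2; zero_set L \<inter> supp2 T2 u = {};
        f \<in> laurent_functions; g \<in> laurent_functions\<rbrakk>
       \<Longrightarrow> admissible Cstar2 (topspace T2) u (tensor_cnj f (\<lambda>z. g z / laurent_eval L z))"

type_synonym form = "(complex \<Rightarrow> complex) \<Rightarrow> (complex \<Rightarrow> complex) \<Rightarrow> complex"

definition sesq_form ::
    "(complex \<times> complex \<Rightarrow> complex) topology \<Rightarrow> ((complex \<times> complex \<Rightarrow> complex) \<Rightarrow> complex) \<Rightarrow> form" where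
  "sesq_form T u f g = eval_functional Cstar2 (topspace T) u (tensor_cnj f g)"

definition form12 ::
    "(complex \<times> complex \<Rightarrow> complex) topology \<Rightarrow> ((complex \<times> complex \<Rightarrow> complex) \<Rightarrow> complex)
      \<Rightarrow> laurent \<Rightarrow> laurent \<Rightarrow> nat \<Rightarrow> (nat \<Rightarrow> complex) \<Rightarrow> (nat \<Rightarrow> nat)
      \<Rightarrow> (nat \<Rightarrow> nat \<Rightarrow> (complex \<Rightarrow> complex) \<Rightarrow> complex) \<Rightarrow> form" where
  "form12 T u L\<Gamma> L\<CC> d \<zeta> m \<xi> f g =
     sesq_form T u (\<lambda>z. f z / laurent_eval L\<Gamma> z) (\<lambda>z. laurent_eval L\<CC> z * g z)
     + (\<Sum>i = 1..d. \<Sum>l<m i. 1 / fact l * (deriv ^^ l) f (\<zeta> i)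
          * cnj (\<xi> i l (\<lambda>z. laurent_eval L\<CC> z * g z)))"

definition form21 ::
    "(complex \<times> complex \<Rightarrow> complex) topology \<Rightarrow> ((complex \<times> complex \<Rightarrow> complex) \<Rightarrow> complex)
      \<Rightarrow> laurent \<Rightarrow> laurent \<Rightarrow> nat \<Rightarrow> (nat \<Rightarrow> complex) \<Rightarrow> (nat \<Rightarrow> nat)
      \<Rightarrow> (nat \<Rightarrow> nat \<Rightarrow> (complex \<Rightarrow> complex) \<Rightarrow> complex) \<Rightarrow> form" where
  "form21 T u L\<Gamma> L\<CC> d \<zeta> m \<xi> f g =
     sesq_form T u (\<lambda>z. laurent_eval L\<CC> z * f z) (\<lambda>z. g z / laurent_eval L\<Gamma> z)
     + (\<Sum>i = 1..d. \<Sum>l<m i. 1 / fact l * \<xi> i l (\<lambda>z. laurent_eval L\<CC> z * f z)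
          * cnj ((deriv ^^ l) g (\<zeta> i)))"

type_synonym smat = "nat \<Rightarrow> nat \<Rightarrow> complex"

text \<open>Products are only used when each defining sum has finitely many nonzero terms;
  \<^const>\<open>Sum_any\<close> is the sum over all indices with nonzero summand.\<close>

definition smat_mult :: "smat \<Rightarrow> smat \<Rightarrow> smat" (infixl \<open>\<star>\<^sub>s\<close> 70) where
  "A \<star>\<^sub>s B = (\<lambda>i j. Sum_any (\<lambda>k. A i k * B k j))"

definition smat_vec :: "smat \<Rightarrow> (nat \<Rightarrow> complex) \<Rightarrow> nat \<Rightarrow> complex" where
  "smat_vec A v = (\<lambda>i. Sum_any (\<lambda>k. A i k * v k))"

definition smat_diag :: "(nat \<Rightarrow> complex) \<Rightarrow> smat" where
  "smat_diag h = (\<lambda>i j. if i = j then h i else 0)"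

definition smat_one :: smat where
  "smat_one = smat_diag (\<lambda>_. 1)"

definition smat_transpose :: "smat \<Rightarrow> smat" where
  "smat_transpose A = (\<lambda>i j. A j i)"

definition smat_dagger :: "smat \<Rightarrow> smat" where
  "smat_dagger A = (\<lambda>i j. cnj (A j i))"

primrec smat_power :: "smat \<Rightarrow> nat \<Rightarrow> smat" where
  "smat_power A 0 = smat_one"
| "smat_power A (Suc n) = A \<star>\<^sub>s smat_power A n"

definition lower_unitriangular :: "smat \<Rightarrow> bool" where
  "lower_unitriangular S \<longleftrightarrow> (\<forall>i. S i i = 1) \<and> (\<forall>i j. i < j \<longrightarrow> S i j = 0)"

definition unitri_inverse :: "smat \<Rightarrow> smat" where
  "unitri_inverse S =
     (THE R. lower_unitriangular R \<and> S \<star>\<^sub>s R = smat_one \<and> R \<star>\<^sub>s S = smat_one)"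

definition quasidefinite :: "smat \<Rightarrow> bool" where
  "quasidefinite G \<longleftrightarrow> (\<forall>n\<ge>1. Determinant.det (Matrix.mat n n (\<lambda>(i, j). G i j)) \<noteq> 0)"

definition gauss_borel :: "smat \<Rightarrow> smat \<Rightarrow> (nat \<Rightarrow> complex) \<Rightarrow> smat \<Rightarrow> bool" where
  "gauss_borel G S1 H S2 \<longleftrightarrow>
     lower_unitriangular S1 \<and> lower_unitriangular S2 \<and> (\<forall>k. H k \<noteq> 0) \<and>
     G = unitri_inverse S1 \<star>\<^sub>s smat_diag H \<star>\<^sub>s smat_dagger (unitri_inverse S2)"

definition cmv :: "nat \<Rightarrow> complex \<Rightarrow> complex" where
  "cmv k z = (if even k then z powi int (k div 2) else z powi (- int (k div 2) - 1))"

definition Upsilon :: smat where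
  "Upsilon = (\<lambda>i j. if even i \<and> j = i + 2 \<or> i = 1 \<and> j = 0 \<or> odd i \<and> 3 \<le> i \<and> j + 2 = i
                    then 1 else 0)"

text \<open>Integer powers of \<open>\<Upsilon>\<close> use that its inverse is its transpose.\<close>

definition Upsilon_powi :: "int \<Rightarrow> smat" where
  "Upsilon_powi k =
     (if k \<ge> 0 then smat_power Upsilon (nat k)
      else smat_power (smat_transpose Upsilon) (nat (- k)))"

definition laurent_Upsilon :: "laurent \<Rightarrow> smat" where
  "laurent_Upsilon L =
     (\<lambda>i j. \<Sum>k\<in>Poly_Mapping.keys L. Poly_Mapping.lookup L k * Upsilon_powi k i j)"

definition gram :: "form \<Rightarrow> smat" where
  "gram B = (\<lambda>k l. B (cmv k) (cmv l))"

definition phi :: "smat \<Rightarrow> nat \<Rightarrow> complex \<Rightarrow> complex" where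
  "phi S k z = smat_vec S (\<lambda>j. cmv j z) k"

text \<open>\<open>cd_kernel S\<^sub>1 H S\<^sub>2 l z\<^sub>1 z\<^sub>2\<close> is \<open>K\<^bsup>[l]\<^esup>(cnj z\<^sub>1, z\<^sub>2)\<close>: the conjugation of the first
  variable is built in.\<close>

definition cd_kernel ::
    "smat \<Rightarrow> (nat \<Rightarrow> complex) \<Rightarrow> smat \<Rightarrow> nat \<Rightarrow> complex \<Rightarrow> complex \<Rightarrow> complex" where
  "cd_kernel S1 H S2 l z1 z2 = (\<Sum>k<l. cnj (phi S2 k z1) * inverse (H k) * phi S1 k z2)"

definition connector :: "smat \<Rightarrow> laurent \<Rightarrow> smat \<Rightarrow> smat" where
  "connector S' L S = S' \<star>\<^sub>s laurent_Upsilon L \<star>\<^sub>s unitri_inverse S"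

definition Gamma_block :: "smat \<Rightarrow> nat \<Rightarrow> nat \<Rightarrow> complex Matrix.mat" where
  "Gamma_block \<Omega> N l = Matrix.mat (2 * N) (2 * N) (\<lambda>(i, j). \<Omega> (l + i) (l - 2 * N + j))"

definition C_block :: "smat \<Rightarrow> nat \<Rightarrow> nat \<Rightarrow> complex Matrix.mat" where
  "C_block \<Omega> N l = Matrix.mat (2 * N) (2 * N) (\<lambda>(i, j). \<Omega> (l - 2 * N + i) (l + j))"

end

theory Submission
  imports Defs
begin

text \<open>Put \<open>\<Omega>\<^sub>1 = S\<^sub>1 L\<^sub>\<Gamma>(\<Upsilon>) S'\<^sub>1\<^sup>-\<^sup>1\<close> and \<open>\<Omega>\<^sub>2 = S'\<^sub>2 L\<^sub>\<CC>(\<Upsilon>) S\<^sub>2\<^sup>-\<^sup>1\<close>, the primes denoting the perturbed data. In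
  the perturbed form, \<open>L\<^sub>\<Gamma> f\<close> cancels the denominator and annihilates the masses, so that
  \<open>L\<^sub>\<Gamma>(\<Upsilon>) G' = G L\<^sub>\<CC>(\<Upsilon>)\<^sup>\<dagger>\<close> and hence \<open>\<Omega>\<^sub>1 H' = H \<Omega>\<^sub>2\<^sup>\<dagger>\<close>; in particular \<open>\<Omega>\<^sub>2\<close> is banded from both
  sides. Since \<open>\<Omega>\<^sub>2 \<phi>\<^sub>2 = L\<^sub>\<CC> \<phi>'\<^sub>2\<close> and \<open>\<Omega>\<^sub>1 \<phi>'\<^sub>1 = L\<^sub>\<Gamma> \<phi>\<^sub>1\<close>, the two kernels are sums of the same
  double array, over the first \<open>l\<close> rows and over the first \<open>l\<close> columns, and their difference consists
  of the two corners of the band beyond the \<open>l\<close>-by-\<open>l\<close> square. The second formula is the conjugate of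
  the first one for the transposed conjugate Gram matrices.\<close>

section \<open>Row-banded semi-infinite matrices\<close>

text \<open>Only the distance above the diagonal is bounded. Since columns are indexed by natural
  numbers, this already makes every row finite, so that products with an arbitrary right factor are
  finite sums.\<close>

definition row_banded :: "nat \<Rightarrow> smat \<Rightarrow> bool" where
  "row_banded a A \<longleftrightarrow> (\<forall>i j. i + a < j \<longrightarrow> A i j = 0)"

text \<open>The bound \<open>n\<close> is left free so that several rows, or several matrices, can
  be summed over one common range.\<close>

lemma smat_mult_row_banded:
  assumes "row_banded a A" "i + a \<le> n"
  shows "(A \<star>\<^sub>s B) i j = (\<Sum>k\<le>n. A i k * B k j)"
  unfolding smat_mult_def
  by (rule Sum_any.expand_superset) (use assms in \<open>auto simp: row_banded_def intro: ccontr\<close>)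

text \<open>A vector is treated as a matrix with constant columns, and \<open>j\<close> is any
  column. Facts about \<open>smat_vec\<close> then follow from those about products.\<close>

lemma smat_vec_eq_mult: "smat_vec A v i = (A \<star>\<^sub>s (\<lambda>k _. v k)) i j"
  by (simp add: smat_vec_def smat_mult_def)

lemma smat_vec_row_banded:
  assumes "row_banded a A" "i + a \<le> n"
  shows "smat_vec A v i = (\<Sum>k\<le>n. A i k * v k)"
  using smat_mult_row_banded[OF assms] by (simp add: smat_vec_eq_mult[of A v i 0])

lemma row_banded_mult:
  assumes "row_banded a A" "row_banded b B"
  shows "row_banded (a + b) (A \<star>\<^sub>s B)"
  unfolding row_banded_def
proof (intro allI impI)
  fix i j :: nat assume "i + (a + b) < j"
  then have "\<And>k. k \<le> i + a \<Longrightarrow> B k j = 0"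
    using assms(2) by (auto simp: row_banded_def)
  then show "(A \<star>\<^sub>s B) i j = 0"
    by (simp add: smat_mult_row_banded[OF assms(1) order_refl])
qed

text \<open>Associativity can fail for semi-infinite matrices. Finite rows of the two left factors
  make it an interchange of finite sums; \<open>C\<close> stays arbitrary because Gram matrices are
  full.\<close>

lemma smat_mult_assoc:
  assumes A: "row_banded a A" and B: "row_banded b B"
  shows "A \<star>\<^sub>s B \<star>\<^sub>s C = A \<star>\<^sub>s (B \<star>\<^sub>s C)"
proof (intro ext)
  fix i j
  have "(A \<star>\<^sub>s B \<star>\<^sub>s C) i j = (\<Sum>k\<le>i + (a + b). (\<Sum>m\<le>i + a. A i m * B m k) * C k j)"
    by (simp add: smat_mult_row_banded[OF row_banded_mult[OF A B] order_refl]
        smat_mult_row_banded[OF A order_refl])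
  also have "\<dots> = (\<Sum>m\<le>i + a. A i m * (\<Sum>k\<le>i + (a + b). B m k * C k j))"
    unfolding sum_distrib_left sum_distrib_right mult.assoc by (rule sum.swap)
  also have "\<dots> = (A \<star>\<^sub>s (B \<star>\<^sub>s C)) i j"
    unfolding smat_mult_row_banded[OF A order_refl]
    by (intro sum.cong refl) (simp add: smat_mult_row_banded[OF B, of _ "i + (a + b)"])
  finally show "(A \<star>\<^sub>s B \<star>\<^sub>s C) i j = (A \<star>\<^sub>s (B \<star>\<^sub>s C)) i j" .
qed

lemma smat_vec_mult:
  assumes "row_banded a A" "row_banded b B"
  shows "smat_vec (A \<star>\<^sub>s B) v = smat_vec A (smat_vec B v)"
proof
  fix i
  have "(B \<star>\<^sub>s (\<lambda>k _. v k)) = (\<lambda>k _. smat_vec B v k)"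
    by (intro ext) (rule smat_vec_eq_mult[symmetric])
  then show "smat_vec (A \<star>\<^sub>s B) v i = smat_vec A (smat_vec B v) i"
    by (simp add: smat_vec_eq_mult[of _ _ i 0] smat_mult_assoc[OF assms])
qed

lemma Sum_any_single:
  fixes f :: "'a \<Rightarrow> 'b::comm_monoid_add"
  assumes "\<And>k. k \<noteq> a \<Longrightarrow> f k = 0"
  shows "Sum_any f = f a"
  by (subst Sum_any.expand_superset[of "{a}"]) (use assms in auto)

section \<open>Diagonal matrices and the conjugate transpose\<close>

lemma smat_mult_diag: "(A \<star>\<^sub>s smat_diag h) i j = A i j * h j"
  unfolding smat_mult_def by (subst Sum_any_single[of j]) (auto simp: smat_diag_def)

lemma smat_diag_mult: "(smat_diag h \<star>\<^sub>s A) i j = h i * A i j"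
  unfolding smat_mult_def by (subst Sum_any_single[of i]) (auto simp: smat_diag_def)

lemma smat_mult_one [simp]: "A \<star>\<^sub>s smat_one = A" "smat_one \<star>\<^sub>s A = A"
  by (simp_all add: fun_eq_iff smat_one_def smat_mult_diag smat_diag_mult)

lemma smat_vec_one [simp]: "smat_vec smat_one v = v"
  by (rule ext) (simp add: smat_vec_eq_mult[of _ _ _ 0])

lemma row_banded_diag [simp]: "row_banded 0 (smat_diag h)"
  by (auto simp: row_banded_def smat_diag_def)

lemma row_banded_one [simp]: "row_banded 0 smat_one"
  by (simp add: smat_one_def)

lemma smat_dagger_dagger [simp]: "smat_dagger (smat_dagger A) = A"
  by (simp add: smat_dagger_def)

lemma smat_dagger_diag: "smat_dagger (smat_diag h) = smat_diag (\<lambda>k. cnj (h k))"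
  by (simp add: fun_eq_iff smat_dagger_def smat_diag_def)

lemma smat_dagger_one [simp]: "smat_dagger smat_one = smat_one"
  by (simp add: smat_one_def smat_dagger_diag)

text \<open>Corresponding summands on the two sides vanish together, so the identity holds for all
  matrices: where the set of nonzero summands is infinite, both sums default to 0.\<close>

lemma smat_dagger_mult: "smat_dagger (A \<star>\<^sub>s B) = smat_dagger B \<star>\<^sub>s smat_dagger A"
proof (intro ext)
  fix i j
  have "{k. cnj (A j k) * cnj (B k i) \<noteq> 0} = {k. A j k * B k i \<noteq> 0}"
    by auto
  then show "smat_dagger (A \<star>\<^sub>s B) i j = (smat_dagger B \<star>\<^sub>s smat_dagger A) i j"
    by (simp add: smat_dagger_def smat_mult_def Sum_any.expand_set mult.commute)
qed

text \<open>The mirror image of \<open>smat_mult_assoc\<close>: the two right factors have finite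
  columns and the left one is arbitrary. It serves the upper triangular factors to the right of a
  Gram matrix.\<close>

lemma smat_mult_assoc_dagger:
  assumes "row_banded b (smat_dagger B)" "row_banded c (smat_dagger C)"
  shows "A \<star>\<^sub>s B \<star>\<^sub>s C = A \<star>\<^sub>s (B \<star>\<^sub>s C)"
  using arg_cong[OF smat_mult_assoc[OF assms(2,1), of "smat_dagger A"], of smat_dagger]
  by (simp add: smat_dagger_mult)

section \<open>Inverses of unitriangular matrices\<close>

lemma lower_unitriangular_row_banded: "lower_unitriangular S \<Longrightarrow> row_banded 0 S"
  by (simp add: lower_unitriangular_def row_banded_def)

text \<open>Forward substitution: \<open>S R = 1\<close> is solved for the rows of \<open>R\<close>
  from the top.\<close>

fun unitri_right_inverse :: "smat \<Rightarrow> smat" where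
  "unitri_right_inverse S i j =
     (if i = j then 1 else 0) - (\<Sum>k<i. S i k * unitri_right_inverse S k j)"

declare unitri_right_inverse.simps [simp del]

lemma unitri_right_inverse:
  assumes S: "lower_unitriangular S"
  shows "lower_unitriangular (unitri_right_inverse S)"
    and "S \<star>\<^sub>s unitri_right_inverse S = smat_one"
proof -
  have zero: "unitri_right_inverse S i j = 0" if "i < j" for i j
    using that
  proof (induction i rule: less_induct)
    case (less i)
    then show ?case
      by (subst unitri_right_inverse.simps) simp
  qed
  then have "unitri_right_inverse S i i = 1" for i
    by (subst unitri_right_inverse.simps) simp
  then show "lower_unitriangular (unitri_right_inverse S)"
    by (simp add: lower_unitriangular_def zero)
  show "S \<star>\<^sub>s unitri_right_inverse S = smat_one"
  proof (intro ext)
    fix i j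
    have "(S \<star>\<^sub>s unitri_right_inverse S) i j = (\<Sum>k\<le>i. S i k * unitri_right_inverse S k j)"
      by (rule smat_mult_row_banded[OF lower_unitriangular_row_banded[OF S]]) simp
    also have "\<dots> = (\<Sum>k<i. S i k * unitri_right_inverse S k j) + unitri_right_inverse S i j"
      using S by (simp add: lessThan_Suc_atMost[symmetric] lower_unitriangular_def)
    also have "\<dots> = smat_one i j"
      by (subst (2) unitri_right_inverse.simps) (simp add: smat_one_def smat_diag_def)
    finally show "(S \<star>\<^sub>s unitri_right_inverse S) i j = smat_one i j" .
  qed
qed

text \<open>The right inverse \<open>R\<close> is again unitriangular and so has a right inverse
  \<open>R'\<close>. Then \<open>S = S (R R') = (S R) R' = R'\<close>, so \<open>R\<close> is
  two-sided, and uniqueness resolves the definite description.\<close>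

lemma unitri_inverse:
  assumes S: "lower_unitriangular S"
  shows "lower_unitriangular (unitri_inverse S)"
    and "S \<star>\<^sub>s unitri_inverse S = smat_one"
    and "unitri_inverse S \<star>\<^sub>s S = smat_one"
proof -
  define R where "R = unitri_right_inverse S"
  define R' where "R' = unitri_right_inverse R"
  have R: "lower_unitriangular R" "S \<star>\<^sub>s R = smat_one"
    using unitri_right_inverse[OF S] by (auto simp: R_def)
  have R': "R \<star>\<^sub>s R' = smat_one"
    using unitri_right_inverse(2)[OF R(1)] by (simp add: R'_def)
  note band = lower_unitriangular_row_banded[OF S] lower_unitriangular_row_banded[OF R(1)]
  have "S = R'"
    using smat_mult_assoc[OF band, of R'] R R' by simp
  with R' have inv: "R \<star>\<^sub>s S = smat_one" by simp
  have uniq: "Q = R" if "lower_unitriangular Q \<and> S \<star>\<^sub>s Q = smat_one \<and> Q \<star>\<^sub>s S = smat_one" for Q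
  proof -
    from that have "row_banded 0 Q"
      by (simp add: lower_unitriangular_row_banded)
    from smat_mult_assoc[OF this band(1), of R] have "smat_one \<star>\<^sub>s R = Q \<star>\<^sub>s smat_one"
      using that R(2) by argo
    then show ?thesis
      by simp
  qed
  have "unitri_inverse S = R"
    unfolding unitri_inverse_def using R inv by (intro the_equality uniq) simp_all
  then show "lower_unitriangular (unitri_inverse S)" "S \<star>\<^sub>s unitri_inverse S = smat_one"
    "unitri_inverse S \<star>\<^sub>s S = smat_one"
    using R inv by auto
qed

section \<open>Laurent polynomials in the shift matrix\<close>

lemma laurent_eval_superset:
  assumes "finite K" "Poly_Mapping.keys L \<subseteq> K"
  shows "laurent_eval L z = (\<Sum>k\<in>K. Poly_Mapping.lookup L k * z powi k)"
  unfolding laurent_eval_def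
  by (rule sum.mono_neutral_left) (use assms in \<open>auto simp: in_keys_iff\<close>)

text \<open>The CMV order lists the exponents 0, -1, 1, -2, 2, and so on. This map sends the index
  of an exponent to the index of the next larger exponent; \<open>Upsilon\<close> is its permutation
  matrix and the transpose is that of \<open>shift_down\<close>.\<close>

definition shift_up :: "nat \<Rightarrow> nat" where
  "shift_up i = (if even i then i + 2 else if i = 1 then 0 else i - 2)"

definition shift_down :: "nat \<Rightarrow> nat" where
  "shift_down i = (if odd i then i + 2 else if i = 0 then 1 else i - 2)"

lemma Upsilon_shift_up: "Upsilon i j = (if j = shift_up i then 1 else 0)"
proof -
  have "odd i \<Longrightarrow> i \<noteq> 1 \<Longrightarrow> 3 \<le> i"
    by presburger
  then show ?thesis
    by (auto simp: Upsilon_def shift_up_def)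
qed

lemma shift_up_down: "shift_up (shift_down i) = i" and shift_down_up: "shift_down (shift_up i) = i"
proof -
  have "odd i \<Longrightarrow> i \<noteq> 1 \<Longrightarrow> 3 \<le> i" "even i \<Longrightarrow> i \<noteq> 0 \<Longrightarrow> 2 \<le> i"
    "even i \<Longrightarrow> i - 2 \<noteq> Suc 0"
    by presburger+
  then show "shift_up (shift_down i) = i" "shift_down (shift_up i) = i"
    by (auto simp: shift_up_def shift_down_def)
qed

lemma Upsilon_transpose_shift_down:
  "smat_transpose Upsilon i j = (if j = shift_down i then 1 else 0)"
  by (auto simp: smat_transpose_def Upsilon_shift_up shift_up_down shift_down_up)

lemma row_banded_Upsilon: "row_banded 2 Upsilon" "row_banded 2 (smat_transpose Upsilon)"
  by (auto simp: row_banded_def Upsilon_shift_up Upsilon_transpose_shift_down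
      shift_up_def shift_down_def)

lemma cmv_shift_up:
  assumes "z \<noteq> 0"
  shows "cmv (shift_up i) z = z * cmv i z"
proof -
  obtain k where k: "i = 2 * k \<or> i = 2 * k + 1"
    by (metis oddE evenE)
  show ?thesis
  proof (cases k)
    \<comment> \<open>This case contains the exceptional index \<open>i = 1\<close>, where the shift
      passes from the negative powers to the constant function.\<close>
    case 0
    with k show ?thesis
      using assms by (auto simp: cmv_def shift_up_def)
  next
    case (Suc n)
    with k have "i = 2 * Suc n \<or> i = 2 * Suc n + 1"
      by simp
    moreover have "z powi (- int n - 1) = z * z powi (- 2 - int n)"
    proof -
      have eq: "- int n - 1 = (- 2 - int n) + 1"
        by simp
      show ?thesis
        unfolding eq by (rule power_int_add_1') (use assms in simp)
    qed
    moreover have "z powi int (Suc (Suc n)) = z * z powi int (Suc n)"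
      by (simp only: power_int_of_nat power_Suc)
    ultimately show ?thesis
      by (elim disjE) (simp_all add: cmv_def shift_up_def minus_diff_commute)
  qed
qed

lemma cmv_shift_down:
  assumes "z \<noteq> 0"
  shows "cmv (shift_down i) z = inverse z * cmv i z"
  using cmv_shift_up[OF assms, of "shift_down i"] assms by (simp add: shift_up_down field_simps)

lemma Upsilon_cmv:
  assumes "z \<noteq> 0"
  shows "smat_vec Upsilon (\<lambda>j. cmv j z) i = z * cmv i z"
    and "smat_vec (smat_transpose Upsilon) (\<lambda>j. cmv j z) i = inverse z * cmv i z"
proof -
  show "smat_vec Upsilon (\<lambda>j. cmv j z) i = z * cmv i z"
    unfolding smat_vec_def
    by (subst Sum_any_single[of "shift_up i"]) (simp_all add: Upsilon_shift_up cmv_shift_up assms)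
  show "smat_vec (smat_transpose Upsilon) (\<lambda>j. cmv j z) i = inverse z * cmv i z"
    unfolding smat_vec_def
    by (subst Sum_any_single[of "shift_down i"])
      (simp_all add: Upsilon_transpose_shift_down cmv_shift_down assms)
qed

lemma row_banded_power: "row_banded a A \<Longrightarrow> row_banded (n * a) (smat_power A n)"
  by (induction n) (auto intro: row_banded_mult)

lemma smat_vec_scale:
  assumes "row_banded a A"
  shows "smat_vec A (\<lambda>k. c * v k) i = c * smat_vec A v i"
  by (simp add: smat_vec_row_banded[OF assms order_refl] sum_distrib_left mult.left_commute)

text \<open>For fixed nonzero \<open>z\<close> the CMV vector is an eigenvector of
  \<open>Upsilon\<close> with eigenvalue \<open>z\<close>, and of the transpose with eigenvalue
  \<open>inverse z\<close>; this gives the action of all integer powers.\<close>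

lemma smat_vec_power_eigen:
  assumes A: "row_banded a A" and eigen: "smat_vec A v = (\<lambda>i. c * v i)"
  shows "smat_vec (smat_power A n) v = (\<lambda>i. c ^ n * v i)"
proof (induction n)
  case (Suc n)
  then show ?case
    by (auto simp: smat_vec_mult[OF A row_banded_power[OF A]] smat_vec_scale[OF A] eigen)
qed simp

lemma row_banded_Upsilon_powi: "row_banded (2 * nat \<bar>k\<bar>) (Upsilon_powi k)"
  using row_banded_power[OF row_banded_Upsilon(1), of "nat k"]
    row_banded_power[OF row_banded_Upsilon(2), of "nat (- k)"]
  by (auto simp: Upsilon_powi_def mult.commute abs_if)

lemma Upsilon_powi_cmv:
  assumes "z \<noteq> 0"
  shows "smat_vec (Upsilon_powi k) (\<lambda>j. cmv j z) i = z powi k * cmv i z"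
proof (cases "k \<ge> 0")
  case True
  then show ?thesis
    using smat_vec_power_eigen[OF row_banded_Upsilon(1), of "\<lambda>j. cmv j z" z "nat k"]
    by (simp add: fun_eq_iff Upsilon_powi_def Upsilon_cmv assms power_int_def)
next
  case False
  then show ?thesis
    using smat_vec_power_eigen[OF row_banded_Upsilon(2), of "\<lambda>j. cmv j z" "inverse z" "nat (- k)"]
    by (simp add: fun_eq_iff Upsilon_powi_def Upsilon_cmv assms power_int_def)
qed

lemma row_banded_laurent_Upsilon:
  assumes "laurent_span L Np Nm"
  shows "row_banded (2 * max Np Nm) (laurent_Upsilon L)"
  unfolding row_banded_def laurent_Upsilon_def
proof (intro allI impI sum.neutral ballI)
  fix i j k assume ij: "i + 2 * max Np Nm < j" and "k \<in> Poly_Mapping.keys L"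
  with assms have "k \<in> {- int Nm..int Np}"
    by (auto simp: laurent_span_def)
  then have "nat \<bar>k\<bar> \<le> max Np Nm"
    by auto
  with ij have "i + 2 * nat \<bar>k\<bar> < j"
    by simp
  then have "Upsilon_powi k i j = 0"
    using row_banded_Upsilon_powi[of k] by (simp add: row_banded_def)
  then show "Poly_Mapping.lookup L k * Upsilon_powi k i j = 0"
    by simp
qed

text \<open>All powers that occur in \<open>L\<close> fit into the common column range up to
  \<open>?n\<close>, so the sum over exponents can be exchanged with the sum over columns.\<close>

lemma laurent_Upsilon_cmv:
  assumes L: "laurent_span L Np Nm" and z: "z \<noteq> 0"
  shows "smat_vec (laurent_Upsilon L) (\<lambda>j. cmv j z) i = laurent_eval L z * cmv i z"
proof -
  let ?n = "i + 2 * max Np Nm"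
  have "(\<Sum>j\<le>?n. Upsilon_powi k i j * cmv j z) = z powi k * cmv i z"
    if "k \<in> Poly_Mapping.keys L" for k
  proof -
    from that L have "k \<in> {- int Nm..int Np}"
      by (auto simp: laurent_span_def)
    then have "nat \<bar>k\<bar> \<le> max Np Nm"
      by auto
    then have "i + 2 * nat \<bar>k\<bar> \<le> ?n"
      by simp
    from smat_vec_row_banded[OF row_banded_Upsilon_powi this, of "\<lambda>j. cmv j z"] show ?thesis
      by (simp add: Upsilon_powi_cmv z)
  qed
  then have "laurent_eval L z * cmv i z
      = (\<Sum>k\<in>Poly_Mapping.keys L. Poly_Mapping.lookup L k * (\<Sum>j\<le>?n. Upsilon_powi k i j * cmv j z))"
    by (simp add: laurent_eval_def sum_distrib_right mult.assoc)
  also have "\<dots> = (\<Sum>j\<le>?n. laurent_Upsilon L i j * cmv j z)"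
    unfolding laurent_Upsilon_def sum_distrib_left sum_distrib_right mult.assoc by (rule sum.swap)
  also have "\<dots> = smat_vec (laurent_Upsilon L) (\<lambda>j. cmv j z) i"
    by (rule smat_vec_row_banded[OF row_banded_laurent_Upsilon[OF L], symmetric]) simp
  finally show ?thesis by simp
qed

section \<open>Connectors and kernels\<close>

text \<open>Unitriangular factors have upper bandwidth 0, so only the Laurent polynomial
  contributes. The lower half of the band is obtained from
  \<open>connector_relation\<close>.\<close>

lemma connector_row_banded:
  assumes "lower_unitriangular S'" "lower_unitriangular S" "laurent_span L Np Nm"
  shows "row_banded (2 * max Np Nm) (connector S' L S)"
  using row_banded_mult[OF row_banded_mult[OF lower_unitriangular_row_banded[OF assms(1)]
        row_banded_laurent_Upsilon[OF assms(3)]]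
      lower_unitriangular_row_banded[OF unitri_inverse(1)[OF assms(2)]]]
  by (simp add: connector_def)

text \<open>Reading the connector from the right: the inverse of \<open>S\<close> returns
  \<open>phi S\<close> to the CMV vector, the middle factor multiplies that vector by the scalar
  \<open>laurent_eval L z\<close>, and \<open>S'\<close> produces \<open>phi S'\<close>.\<close>

lemma connector_phi:
  assumes S': "lower_unitriangular S'" and S: "lower_unitriangular S"
    and L: "laurent_span L Np Nm" and z: "z \<noteq> 0"
  shows "smat_vec (connector S' L S) (\<lambda>k. phi S k z) i = laurent_eval L z * phi S' i z"
proof -
  note bS = lower_unitriangular_row_banded[OF S]
  note bR = lower_unitriangular_row_banded[OF unitri_inverse(1)[OF S]]
  note bS' = lower_unitriangular_row_banded[OF S']
  note bL = row_banded_laurent_Upsilon[OF L]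
  have phi: "(\<lambda>k. phi T k z) = smat_vec T (\<lambda>j. cmv j z)" for T
    by (simp add: phi_def fun_eq_iff)
  have "smat_vec (connector S' L S) (\<lambda>k. phi S k z)
      = smat_vec (S' \<star>\<^sub>s laurent_Upsilon L) (smat_vec (unitri_inverse S) (smat_vec S (\<lambda>j. cmv j z)))"
    by (simp add: phi connector_def smat_vec_mult[OF row_banded_mult[OF bS' bL] bR])
  also have "\<dots> = smat_vec S' (smat_vec (laurent_Upsilon L) (\<lambda>j. cmv j z))"
    by (simp add: smat_vec_mult[OF bR bS, symmetric] unitri_inverse(3)[OF S]
        smat_vec_mult[OF bS' bL])
  also have "smat_vec (laurent_Upsilon L) (\<lambda>j. cmv j z) = (\<lambda>j. laurent_eval L z * cmv j z)"
    by (rule ext) (rule laurent_Upsilon_cmv[OF L z])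
  finally show ?thesis
    by (simp add: smat_vec_scale[OF bS'] phi_def)
qed

lemma gauss_borel_lower_unitriangular:
  assumes "gauss_borel G S1 H S2"
  shows "lower_unitriangular S1" "lower_unitriangular S2"
  using assms by (auto simp: gauss_borel_def)

text \<open>This exchange of \<open>S1\<close> and \<open>S2\<close> is what reduces the (2,1)
  perturbation to the (1,2) one.\<close>

lemma gauss_borel_dagger:
  assumes "gauss_borel G S1 H S2"
  shows "gauss_borel (smat_dagger G) S2 (\<lambda>k. cnj (H k)) S1"
proof -
  from assms have S: "lower_unitriangular S2"
    and G: "G = unitri_inverse S1 \<star>\<^sub>s smat_diag H \<star>\<^sub>s smat_dagger (unitri_inverse S2)"
    by (auto simp: gauss_borel_def)
  have "smat_dagger G = unitri_inverse S2 \<star>\<^sub>s smat_diag (\<lambda>k. cnj (H k)) \<star>\<^sub>s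
      smat_dagger (unitri_inverse S1)"
    by (simp add: G smat_dagger_mult smat_dagger_diag
        smat_mult_assoc[OF lower_unitriangular_row_banded[OF unitri_inverse(1)[OF S]] row_banded_diag])
  with assms show ?thesis
    by (simp add: gauss_borel_def)
qed

text \<open>Both sides are \<open>S\<^sub>1 L(\<Upsilon>) G' S'\<^sub>2\<^sup>\<dagger> = S\<^sub>1 G M(\<Upsilon>)\<^sup>\<dagger> S'\<^sub>2\<^sup>\<dagger>\<close>.\<close>

lemma connector_relation:
  assumes GB: "gauss_borel G S1 H S2" and GB': "gauss_borel G' S1' H' S2'"
    and L: "laurent_span L Np Nm" and M: "laurent_span M Np' Nm'"
    and gram_relation: "laurent_Upsilon L \<star>\<^sub>s G' = G \<star>\<^sub>s smat_dagger (laurent_Upsilon M)"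
  shows "connector S1 L S1' p q * H' q = H p * cnj (connector S2' M S2 q p)"
proof -
  let ?A = "laurent_Upsilon L" and ?B = "laurent_Upsilon M"
  let ?D = "smat_diag H" and ?D' = "smat_diag H'"
  let ?R1 = "unitri_inverse S1" and ?R2 = "unitri_inverse S2"
  let ?R1' = "unitri_inverse S1'" and ?R2' = "unitri_inverse S2'"
  note lu = gauss_borel_lower_unitriangular[OF GB] gauss_borel_lower_unitriangular[OF GB']
  note bS1 = lower_unitriangular_row_banded[OF lu(1)]
  note bS2' = lower_unitriangular_row_banded[OF lu(4)]
  note bR1 = lower_unitriangular_row_banded[OF unitri_inverse(1)[OF lu(1)]]
  note bR2 = lower_unitriangular_row_banded[OF unitri_inverse(1)[OF lu(2)]]
  note bR1' = lower_unitriangular_row_banded[OF unitri_inverse(1)[OF lu(3)]]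
  note bR2' = lower_unitriangular_row_banded[OF unitri_inverse(1)[OF lu(4)]]
  note bA = row_banded_laurent_Upsilon[OF L]
  note bB = row_banded_laurent_Upsilon[OF M]
  note bX = row_banded_mult[OF bR1' row_banded_diag[of H']]
  have G: "G = ?R1 \<star>\<^sub>s ?D \<star>\<^sub>s smat_dagger ?R2" and G': "G' = ?R1' \<star>\<^sub>s ?D' \<star>\<^sub>s smat_dagger ?R2'"
    using GB GB' by (auto simp: gauss_borel_def)
  have "S1 \<star>\<^sub>s (?A \<star>\<^sub>s G') = S1 \<star>\<^sub>s (?A \<star>\<^sub>s (?R1' \<star>\<^sub>s ?D')) \<star>\<^sub>s smat_dagger ?R2'"
    by (simp add: G' smat_mult_assoc[OF bA bX] smat_mult_assoc[OF bS1 row_banded_mult[OF bA bX]])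
  also have "S1 \<star>\<^sub>s (?A \<star>\<^sub>s (?R1' \<star>\<^sub>s ?D')) = connector S1 L S1' \<star>\<^sub>s ?D'"
    by (simp add: connector_def smat_mult_assoc[OF bS1 bA]
        smat_mult_assoc[OF bA bR1'] smat_mult_assoc[OF bS1 row_banded_mult[OF bA bR1']])
  \<comment> \<open>The factors on the right are upper triangular and may have infinite rows, so
    they are regrouped through their finite columns.\<close>
  finally have "S1 \<star>\<^sub>s (?A \<star>\<^sub>s G') \<star>\<^sub>s smat_dagger S2'
      = connector S1 L S1' \<star>\<^sub>s ?D' \<star>\<^sub>s smat_dagger (S2' \<star>\<^sub>s ?R2')"
    using smat_mult_assoc_dagger[of 0 "smat_dagger ?R2'" 0 "smat_dagger S2'"] bR2' bS2'
    by (simp add: smat_dagger_mult)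
  then have left: "S1 \<star>\<^sub>s (?A \<star>\<^sub>s G') \<star>\<^sub>s smat_dagger S2' = connector S1 L S1' \<star>\<^sub>s ?D'"
    by (simp add: unitri_inverse(2)[OF lu(4)])
  have "G \<star>\<^sub>s smat_dagger ?B = ?R1 \<star>\<^sub>s ?D \<star>\<^sub>s smat_dagger (?B \<star>\<^sub>s ?R2)"
    using smat_mult_assoc_dagger[of _ "smat_dagger ?R2" _ "smat_dagger ?B"] bR2 bB
    by (simp add: G smat_dagger_mult)
  then have "S1 \<star>\<^sub>s (G \<star>\<^sub>s smat_dagger ?B) = S1 \<star>\<^sub>s ?R1 \<star>\<^sub>s ?D \<star>\<^sub>s smat_dagger (?B \<star>\<^sub>s ?R2)"
    by (simp add: smat_mult_assoc[OF bS1 row_banded_mult[OF bR1 row_banded_diag]]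
        smat_mult_assoc[OF bS1 bR1])
  then have "S1 \<star>\<^sub>s (G \<star>\<^sub>s smat_dagger ?B) = ?D \<star>\<^sub>s smat_dagger (?B \<star>\<^sub>s ?R2)"
    by (simp add: unitri_inverse(2)[OF lu(1)])
  then have "S1 \<star>\<^sub>s (G \<star>\<^sub>s smat_dagger ?B) \<star>\<^sub>s smat_dagger S2'
      = ?D \<star>\<^sub>s smat_dagger (S2' \<star>\<^sub>s (?B \<star>\<^sub>s ?R2))"
    using smat_mult_assoc_dagger[of _ "smat_dagger (?B \<star>\<^sub>s ?R2)" _ "smat_dagger S2'"]
      row_banded_mult[OF bB bR2] bS2'
    by (simp add: smat_dagger_mult)
  then have "S1 \<star>\<^sub>s (G \<star>\<^sub>s smat_dagger ?B) \<star>\<^sub>s smat_dagger S2'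
      = ?D \<star>\<^sub>s smat_dagger (connector S2' M S2)"
    by (simp add: connector_def smat_mult_assoc[OF bS2' bB])
  with left gram_relation
  have "(connector S1 L S1' \<star>\<^sub>s ?D') p q = (?D \<star>\<^sub>s smat_dagger (connector S2' M S2)) p q"
    by simp
  then show ?thesis
    by (simp add: smat_dagger_def smat_mult_diag smat_diag_mult)
qed

section \<open>Double sums over a band and the kernel connection formula\<close>

lemma sum_lessThan_add:
  fixes f :: "nat \<Rightarrow> 'a::comm_monoid_add"
  shows "(\<Sum>p<m + n. f p) = (\<Sum>p<m. f p) + (\<Sum>j<n. f (m + j))"
  by (induction n) (simp_all add: add.assoc)

text \<open>A row below \<open>l\<close> reaches a column from \<open>l\<close> on only if its index
  is at least \<open>l - a\<close>, which leaves an \<open>a\<close> by \<open>a\<close> corner. The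
  hypothesis \<open>a \<le> l\<close> makes the natural subtraction exact.\<close>

lemma band_sum_corner:
  fixes F :: "nat \<Rightarrow> nat \<Rightarrow> 'a::comm_monoid_add"
  assumes "a \<le> l" and zero: "\<And>q p. q + a < p \<Longrightarrow> F q p = 0"
  shows "(\<Sum>q<l. \<Sum>p<l + a. F q p)
    = (\<Sum>q<l. \<Sum>p<l. F q p) + (\<Sum>i<a. \<Sum>j<a. F (l - a + i) (l + j))"
proof -
  have "(\<Sum>q<l. \<Sum>j<a. F q (l + j)) = (\<Sum>q<l - a + a. \<Sum>j<a. F q (l + j))"
    using \<open>a \<le> l\<close> by simp
  also have "\<dots> = (\<Sum>i<a. \<Sum>j<a. F (l - a + i) (l + j))"
    unfolding sum_lessThan_add by (simp add: zero)
  finally show ?thesis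
    by (simp add: sum_lessThan_add sum.distrib)
qed

text \<open>Stated for abstract Gram matrices related by \<open>gram_relation\<close>, so that it
  can be applied both to the forms themselves and to their conjugate transposes. The numbers
  \<open>a\<close> and \<open>b\<close> are the upper and lower bandwidths of
  \<open>\<Omega>\<close>.\<close>

lemma cd_kernel_connection:
  assumes GB: "gauss_borel G S1 H S2" and GB': "gauss_borel G' S1' H' S2'"
    and L: "laurent_span L Np Nm" and M: "laurent_span M Np' Nm'"
    and gram_relation: "laurent_Upsilon L \<star>\<^sub>s G' = G \<star>\<^sub>s smat_dagger (laurent_Upsilon M)"
    and b: "b = 2 * max Np Nm" "b \<le> l" and a: "a = 2 * max Np' Nm'" "a \<le> l"
    and z: "z1 \<noteq> 0" "z2 \<noteq> 0"
  defines "\<Omega> \<equiv> connector S2' M S2"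
  shows "cnj (laurent_eval M z1) * cd_kernel S1' H' S2' l z1 z2
      - laurent_eval L z2 * cd_kernel S1 H S2 l z1 z2
    = (\<Sum>i<a. \<Sum>j<a. phi S1' (l - a + i) z2 / H' (l - a + i)
          * cnj (\<Omega> (l - a + i) (l + j)) * cnj (phi S2 (l + j) z1))
      - (\<Sum>i<b. \<Sum>j<b. phi S1' (l + i) z2 / H' (l + i)
          * cnj (\<Omega> (l + i) (l - b + j)) * cnj (phi S2 (l - b + j) z1))"
proof -
  \<comment> \<open>Sums of \<open>F\<close> along rows \<open>q\<close> produce the factor
    \<open>M\<close>, and sums along columns \<open>p\<close> produce the factor
    \<open>L\<close>.\<close>
  define F where "F q p = phi S1' q z2 / H' q * cnj (\<Omega> q p) * cnj (phi S2 p z1)" for q p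
  note lu = gauss_borel_lower_unitriangular[OF GB] gauss_borel_lower_unitriangular[OF GB']
  have nz: "H k \<noteq> 0" "H' k \<noteq> 0" for k
    using GB GB' by (auto simp: gauss_borel_def)
  have b\<Omega>: "row_banded a \<Omega>"
    unfolding \<Omega>_def a by (rule connector_row_banded[OF lu(4,2) M])
  have b\<Omega>': "row_banded b (connector S1 L S1')"
    unfolding b by (rule connector_row_banded[OF lu(1,3) L])
  have rel: "connector S1 L S1' p q = H p * cnj (\<Omega> q p) / H' q" for p q
    using connector_relation[OF GB GB' L M gram_relation, of p q] nz(2)[of q]
    by (simp add: \<Omega>_def field_simps)
  have upper: "F q p = 0" if "q + a < p" for q p
    using that b\<Omega> by (simp add: F_def row_banded_def)
  \<comment> \<open>Up to nonzero factors, \<open>\<Omega> q p\<close> is the conjugate of entry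
    \<open>(p, q)\<close> of the other connector, whose upper band ends at column
    \<open>p + b\<close>.\<close>
  have lower: "F q p = 0" if "p + b < q" for q p
  proof -
    from that b\<Omega>' have "connector S1 L S1' p q = 0"
      by (simp add: row_banded_def)
    with nz show ?thesis
      by (simp add: rel F_def)
  qed
  have "cnj (laurent_eval M z1) * (cnj (phi S2' q z1) * inverse (H' q) * phi S1' q z2)
      = (\<Sum>p<l + a. F q p)" if "q < l" for q
  proof -
    \<comment> \<open>Since \<open>q < l\<close>, row \<open>q\<close> ends at \<open>q + a\<close>,
      which is at most \<open>l + a - 1\<close>; one range thus serves all rows.\<close>
    have "laurent_eval M z1 * phi S2' q z1 = (\<Sum>p\<le>l + a - 1. \<Omega> q p * phi S2 p z1)"
      unfolding \<Omega>_def connector_phi[OF lu(4,2) M z(1), symmetric]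
      by (rule smat_vec_row_banded[OF b\<Omega>[unfolded \<Omega>_def]]) (use that in simp)
    also have "{..l + a - 1} = {..<l + a}"
      using that by auto
    finally have conj: "cnj (laurent_eval M z1) * cnj (phi S2' q z1)
        = (\<Sum>p<l + a. cnj (\<Omega> q p) * cnj (phi S2 p z1))"
      by (simp flip: complex_cnj_mult cnj_sum)
    have "cnj (laurent_eval M z1) * cnj (phi S2' q z1) * (phi S1' q z2 / H' q)
        = (\<Sum>p<l + a. F q p)"
      unfolding conj sum_distrib_right by (simp only: F_def mult_ac)
    then show ?thesis
      by (simp add: field_simps)
  qed
  then have first: "cnj (laurent_eval M z1) * cd_kernel S1' H' S2' l z1 z2
      = (\<Sum>q<l. \<Sum>p<l + a. F q p)"
    by (simp add: cd_kernel_def sum_distrib_left)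
  have "laurent_eval L z2 * (cnj (phi S2 p z1) * inverse (H p) * phi S1 p z2)
      = (\<Sum>q<l + b. F q p)" if "p < l" for p
  proof -
    have "laurent_eval L z2 * phi S1 p z2
        = (\<Sum>q\<le>l + b - 1. connector S1 L S1' p q * phi S1' q z2)"
      unfolding connector_phi[OF lu(1,3) L z(2), symmetric]
      by (rule smat_vec_row_banded[OF b\<Omega>']) (use that in simp)
    also have "{..l + b - 1} = {..<l + b}"
      using that by auto
    finally have "cnj (phi S2 p z1) * inverse (H p) * (laurent_eval L z2 * phi S1 p z2)
        = (\<Sum>q<l + b. cnj (phi S2 p z1) * inverse (H p) * (connector S1 L S1' p q * phi S1' q z2))"
      by (simp add: sum_distrib_left)
    also have "\<dots> = (\<Sum>q<l + b. F q p)"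
      by (intro sum.cong refl) (simp add: rel F_def nz)
    finally show ?thesis
      by (simp add: mult_ac)
  qed
  then have second: "laurent_eval L z2 * cd_kernel S1 H S2 l z1 z2
      = (\<Sum>p<l. \<Sum>q<l + b. F q p)"
    by (simp add: cd_kernel_def sum_distrib_left)
  \<comment> \<open>The corner below the square is the corner to the right of it for the transposed
    array.\<close>
  have "(\<Sum>p<l. \<Sum>q<l + b. F q p)
      = (\<Sum>p<l. \<Sum>q<l. F q p) + (\<Sum>j<b. \<Sum>i<b. F (l + i) (l - b + j))"
    by (rule band_sum_corner[OF b(2), of "\<lambda>p q. F q p"]) (rule lower)
  also have "(\<Sum>p<l. \<Sum>q<l. F q p) = (\<Sum>q<l. \<Sum>p<l. F q p)"
    by (rule sum.swap)
  also have "(\<Sum>j<b. \<Sum>i<b. F (l + i) (l - b + j)) = (\<Sum>i<b. \<Sum>j<b. F (l + i) (l - b + j))"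
    by (rule sum.swap)
  finally show ?thesis
    unfolding first second using band_sum_corner[of a l F, OF a(2) upper] by (simp add: F_def)
qed

text \<open>\<open>C\<close> pairs the head of \<open>v\<close> with the tail of \<open>w\<close>,
  and \<open>D\<close> pairs the tail of \<open>v\<close> with the head of \<open>w\<close>; these
  are the two corner sums of \<open>cd_kernel_connection\<close>.\<close>

lemma antidiagonal_block_form:
  fixes v w :: "nat \<Rightarrow> complex"
  assumes C: "C \<in> carrier_mat a a" and D: "D \<in> carrier_mat b b"
  shows "Matrix.vec (a + b) v
      \<bullet> (four_block_mat (0\<^sub>m a b) C (- D) (0\<^sub>m b a) *\<^sub>v Matrix.vec (b + a) w)
    = (\<Sum>i<a. \<Sum>j<a. v i * C $$ (i, j) * w (b + j))
      - (\<Sum>i<b. \<Sum>j<b. v (a + i) * D $$ (i, j) * w j)"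
  using C D
  by (simp add: scalar_prod_def atLeast0LessThan sum_lessThan_add sum_distrib_left
      sum_negf mult.assoc)

lemma cnj_cd_kernel: "cnj (cd_kernel S2 (\<lambda>k. cnj (H k)) S1 l z2 z1) = cd_kernel S1 H S2 l z1 z2"
  by (simp add: cd_kernel_def mult_ac)

section \<open>Evaluation of functionals near the support\<close>

lemma function_spaceD:
  assumes "function_space X F"
  shows "(\<lambda>x. 0) \<in> F"
    and "f \<in> F \<Longrightarrow> g \<in> F \<Longrightarrow> (\<lambda>x. f x + g x) \<in> F"
    and "f \<in> F \<Longrightarrow> (\<lambda>x. c * f x) \<in> F"
  using assms by (simp_all add: function_space_def)

lemma linear_functionalD:
  assumes "linear_functional X F u"
  shows "f \<in> F \<Longrightarrow> g \<in> F \<Longrightarrow> u (\<lambda>x. f x + g x) = u f + u g"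
    and "f \<in> F \<Longrightarrow> u (\<lambda>x. c * f x) = c * u f"
proof -
  note lin = assms[unfolded linear_functional_def]
  show "f \<in> F \<Longrightarrow> g \<in> F \<Longrightarrow> u (\<lambda>x. f x + g x) = u f + u g"
    using lin[THEN conjunct1] by blast
  show "f \<in> F \<Longrightarrow> u (\<lambda>x. c * f x) = c * u f"
    using lin[THEN conjunct2, THEN conjunct1] by blast
qed

text \<open>Two test functions representing \<open>f\<close> agree on a neighbourhood of the
  support, so the support of their difference avoids it and \<open>u\<close> annihilates the
  difference.\<close>

lemma eval_functional_eqI:
  assumes F: "function_space X F" and u: "linear_functional X F u" and supp: "has_support X F u"
    and g: "g \<in> F" "agree_near X F u g f"
  shows "eval_functional X F u f = u g"
  unfolding eval_functional_def
proof (rule the_equality)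
  fix c assume "\<exists>h\<in>F. agree_near X F u h f \<and> u h = c"
  then obtain h where h: "h \<in> F" "agree_near X F u h f" "u h = c"
    by blast
  obtain V where V: "open V" "supp X F u \<subseteq> V" "\<forall>x\<in>V \<inter> X. g x = f x"
    using g(2) by (auto simp: agree_near_def)
  obtain W where W: "open W" "supp X F u \<subseteq> W" "\<forall>x\<in>W \<inter> X. h x = f x"
    using h(2) by (auto simp: agree_near_def)
  \<comment> \<open>Subtraction is expressed by a sum and a scalar multiple, the operations under
    which \<open>function_space\<close> and \<open>linear_functional\<close> are stated.\<close>
  let ?d = "\<lambda>x. g x + (-1) * h x"
  have mh: "(\<lambda>x. (-1) * h x) \<in> F"
    by (rule function_spaceD(3)[OF F h(1)])
  have d: "?d \<in> F"
    by (rule function_spaceD(2)[OF F g(1) mh])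
  have "{x \<in> X. ?d x \<noteq> 0} \<subseteq> - (V \<inter> W)"
    using V(3) W(3) by auto
  then have "closure {x \<in> X. ?d x \<noteq> 0} \<subseteq> - (V \<inter> W)"
    by (rule closure_minimal) (use V(1) W(1) in auto)
  then have "fun_support X ?d \<subseteq> X - supp X F u"
    using V(2) W(2) by (auto simp: fun_support_def)
  with supp d have "u ?d = 0"
    unfolding has_support_def vanishes_on_def by blast
  moreover have "u ?d = u g + u (\<lambda>x. (-1) * h x)"
    by (rule linear_functionalD(1)[OF u g(1) mh])
  moreover have "u (\<lambda>x. (-1) * h x) = (-1) * u h"
    by (rule linear_functionalD(2)[OF u h(1)])
  ultimately show "c = u g"
    using h(3) by simp
qed (use g in blast)

text \<open>A finite intersection of neighbourhoods of the support is again one, so a single test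
  function represents the whole combination.\<close>

lemma eval_functional_combination:
  assumes F: "function_space X F" and u: "linear_functional X F u" and supp: "has_support X F u"
    and "finite I" and "\<And>i. i \<in> I \<Longrightarrow> admissible X F u (f i)"
  shows "\<exists>g\<in>F. agree_near X F u g (\<lambda>x. \<Sum>i\<in>I. c i * f i x)
    \<and> u g = (\<Sum>i\<in>I. c i * eval_functional X F u (f i))"
  using assms(4,5)
proof (induction I)
  case empty
  have "(\<lambda>x. 0) \<in> F"
    by (rule function_spaceD(1)[OF F])
  \<comment> \<open>Scaling by 0 yields that \<open>u\<close> vanishes on the zero function.\<close>
  moreover from this have "u (\<lambda>x. 0 * 0) = 0 * u (\<lambda>x. 0)"
    by (rule linear_functionalD(2)[OF u])
  ultimately show ?case
    by (intro bexI[of _ "\<lambda>x. 0"]) (auto simp: agree_near_def)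
next
  case (insert i I)
  then obtain g where g: "g \<in> F" "agree_near X F u g (\<lambda>x. \<Sum>i\<in>I. c i * f i x)"
      "u g = (\<Sum>i\<in>I. c i * eval_functional X F u (f i))"
    by blast
  obtain h where h: "h \<in> F" "agree_near X F u h (f i)"
    using insert.prems by (auto simp: admissible_def)
  obtain V where V: "open V" "supp X F u \<subseteq> V" "\<forall>x\<in>V \<inter> X. g x = (\<Sum>i\<in>I. c i * f i x)"
    using g(2) by (auto simp: agree_near_def)
  obtain W where W: "open W" "supp X F u \<subseteq> W" "\<forall>x\<in>W \<inter> X. h x = f i x"
    using h(2) by (auto simp: agree_near_def)
  have ch: "(\<lambda>x. c i * h x) \<in> F"
    by (rule function_spaceD(3)[OF F h(1)])
  then have "(\<lambda>x. c i * h x + g x) \<in> F"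
    by (rule function_spaceD(2)[OF F _ g(1)])
  moreover have "agree_near X F u (\<lambda>x. c i * h x + g x) (\<lambda>x. \<Sum>i\<in>insert i I. c i * f i x)"
    unfolding agree_near_def using V W insert.hyps by (intro exI[of _ "V \<inter> W"]) auto
  moreover have "u (\<lambda>x. c i * h x + g x) = u (\<lambda>x. c i * h x) + u g"
    by (rule linear_functionalD(1)[OF u ch g(1)])
  moreover have "u (\<lambda>x. c i * h x) = c i * u h"
    by (rule linear_functionalD(2)[OF u h(1)])
  moreover have "eval_functional X F u (f i) = u h"
    by (rule eval_functional_eqI[OF F u supp h])
  ultimately show ?case
    using g(3) insert.hyps by (intro bexI[of _ "\<lambda>x. c i * h x + g x"]) auto
qed

text \<open>The functions need not be test functions, and their identity is required only near the
  support. This permits cancelling a denominator that has zeros elsewhere.\<close>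

lemma eval_functional_sum_eq:
  assumes F: "function_space X F" and u: "linear_functional X F u" and supp: "has_support X F u"
    and f: "finite I" "\<And>i. i \<in> I \<Longrightarrow> admissible X F u (f i)"
    and g: "finite J" "\<And>j. j \<in> J \<Longrightarrow> admissible X F u (g j)"
    and V: "open V" "supp X F u \<subseteq> V"
    and eq: "\<And>x. x \<in> V \<inter> X \<Longrightarrow> (\<Sum>i\<in>I. a i * f i x) = (\<Sum>j\<in>J. b j * g j x)"
  shows "(\<Sum>i\<in>I. a i * eval_functional X F u (f i)) = (\<Sum>j\<in>J. b j * eval_functional X F u (g j))"
proof -
  obtain p where p: "p \<in> F" "agree_near X F u p (\<lambda>x. \<Sum>i\<in>I. a i * f i x)"
      "u p = (\<Sum>i\<in>I. a i * eval_functional X F u (f i))"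
    using eval_functional_combination[OF F u supp f(1), of f a, OF f(2)] by blast
  obtain q where q: "q \<in> F" "agree_near X F u q (\<lambda>x. \<Sum>j\<in>J. b j * g j x)"
      "u q = (\<Sum>j\<in>J. b j * eval_functional X F u (g j))"
    using eval_functional_combination[OF F u supp g(1), of g b, OF g(2)] by blast
  obtain W where W: "open W" "supp X F u \<subseteq> W" "\<forall>x\<in>W \<inter> X. p x = (\<Sum>i\<in>I. a i * f i x)"
    using p(2) by (auto simp: agree_near_def)
  have "agree_near X F u p (\<lambda>x. \<Sum>j\<in>J. b j * g j x)"
    unfolding agree_near_def using V W eq by (intro exI[of _ "V \<inter> W"]) auto
  then have "u p = u q"
    using eval_functional_eqI[OF F u supp p(1)] eval_functional_eqI[OF F u supp q(1,2)] by metis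
  with p(3) q(3) show ?thesis by simp
qed

section \<open>Laurent polynomials as functions\<close>

lemma Cstar_iff [simp]: "z \<in> Cstar \<longleftrightarrow> z \<noteq> 0"
  by (simp add: Cstar_def)

lemma open_Cstar: "open Cstar"
  by (simp add: Cstar_def open_Compl)

lemma laurent_eval_holomorphic: "laurent_eval L holomorphic_on Cstar"
  unfolding laurent_eval_def by (intro holomorphic_intros) (auto simp: Cstar_def)

lemma cmv_holomorphic: "cmv k holomorphic_on Cstar"
  unfolding cmv_def by (cases "even k") (auto intro!: holomorphic_intros)

lemma laurent_functions_cmv: "cmv k \<in> laurent_functions"
proof -
  let ?e = "if even k then int (k div 2) else - int (k div 2) - 1"
  have "cmv k z = laurent_eval (Poly_Mapping.single ?e 1) z" for z
    by (simp add: laurent_eval_def cmv_def)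
  then show ?thesis
    unfolding laurent_functions_def by blast
qed

lemma laurent_functions_add:
  assumes "f \<in> laurent_functions" "g \<in> laurent_functions"
  shows "(\<lambda>z. f z + g z) \<in> laurent_functions"
proof -
  obtain P Q where P: "\<forall>z\<in>Cstar. f z = laurent_eval P z" and Q: "\<forall>z\<in>Cstar. g z = laurent_eval Q z"
    using assms unfolding laurent_functions_def by blast
  let ?K = "Poly_Mapping.keys P \<union> Poly_Mapping.keys Q"
  have "laurent_eval P z + laurent_eval Q z = laurent_eval (P + Q) z" for z
    using Poly_Mapping.keys_add[of P Q]
    by (simp add: laurent_eval_superset[of ?K] lookup_add distrib_right sum.distrib)
  with P Q show ?thesis
    unfolding laurent_functions_def by auto
qed

lemma laurent_functions_scale:
  assumes "f \<in> laurent_functions"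
  shows "(\<lambda>z. c * f z) \<in> laurent_functions"
proof -
  obtain P where P: "\<forall>z\<in>Cstar. f z = laurent_eval P z"
    using assms unfolding laurent_functions_def by blast
  let ?Q = "Poly_Mapping.map ((*) c) P"
  \<comment> \<open>In general only an inclusion: for \<open>c = 0\<close> every key
    disappears.\<close>
  have "Poly_Mapping.keys ?Q \<subseteq> Poly_Mapping.keys P"
    by (auto simp: in_keys_iff map.rep_eq when_def)
  then have "c * laurent_eval P z = laurent_eval ?Q z" for z
    unfolding laurent_eval_superset[OF finite_keys subset_refl, of P]
      laurent_eval_superset[OF finite_keys \<open>Poly_Mapping.keys ?Q \<subseteq> _\<close>] sum_distrib_left
    by (intro sum.cong refl) (simp add: map.rep_eq when_def in_keys_iff)
  with P show ?thesis
    unfolding laurent_functions_def by auto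
qed

lemma laurent_functions_sum:
  assumes "\<And>i. i \<in> I \<Longrightarrow> f i \<in> laurent_functions"
  shows "(\<lambda>z. \<Sum>i\<in>I. f i z) \<in> laurent_functions"
  using assms
proof (induction I rule: infinite_finite_induct)
  case (insert i I)
  then show ?case
    by (simp add: laurent_functions_add)
qed (auto simp: laurent_functions_def laurent_eval_def intro: exI[of _ 0])

lemma laurent_functions_cong:
  "f \<in> laurent_functions \<Longrightarrow> (\<And>z. z \<in> Cstar \<Longrightarrow> g z = f z) \<Longrightarrow> g \<in> laurent_functions"
  unfolding laurent_functions_def by auto

text \<open>Row \<open>k\<close> of \<open>laurent_Upsilon L\<close> holds the coordinates of
  \<open>L\<close> times the \<open>k\<close>-th CMV function.\<close>

lemma laurent_eval_cmv_sum:
  assumes "laurent_span L Np Nm" "z \<noteq> 0"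
  shows "laurent_eval L z * cmv k z
    = (\<Sum>j\<le>k + 2 * max Np Nm. laurent_Upsilon L k j * cmv j z)"
  using laurent_Upsilon_cmv[OF assms, of k]
    smat_vec_row_banded[OF row_banded_laurent_Upsilon[OF assms(1)] order_refl]
  by simp

lemma laurent_functions_mult_cmv:
  assumes "laurent_span L Np Nm"
  shows "(\<lambda>z. laurent_eval L z * cmv k z) \<in> laurent_functions"
proof (rule laurent_functions_cong)
  show "(\<lambda>z. \<Sum>j\<le>k + 2 * max Np Nm. laurent_Upsilon L k j * cmv j z) \<in> laurent_functions"
    by (intro laurent_functions_sum laurent_functions_scale laurent_functions_cmv)
qed (simp add: laurent_eval_cmv_sum[OF assms])

section \<open>Derivatives at the zeros of a Laurent polynomial\<close>

lemma higher_deriv_cmult_sum: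
  assumes "finite I" "open S" "z \<in> S" and "\<And>i. i \<in> I \<Longrightarrow> f i holomorphic_on S"
  shows "(deriv ^^ n) (\<lambda>w. \<Sum>i\<in>I. c i * f i w) z = (\<Sum>i\<in>I. c i * (deriv ^^ n) (f i) z)"
  using assms(1,4)
proof (induction I)
  case empty
  then show ?case by simp
next
  case (insert i I)
  then have "(deriv ^^ n) (\<lambda>w. c i * f i w + (\<Sum>i\<in>I. c i * f i w)) z
      = (deriv ^^ n) (\<lambda>w. c i * f i w) z + (deriv ^^ n) (\<lambda>w. \<Sum>i\<in>I. c i * f i w) z"
    by (intro higher_deriv_add[OF _ _ \<open>open S\<close> \<open>z \<in> S\<close>] holomorphic_intros) auto
  with insert show ?case
    by (simp add: higher_deriv_cmult[OF _ \<open>z \<in> S\<close> \<open>open S\<close>])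
qed

text \<open>Near the zero, \<open>L\<close> is \<open>(v - ?w) ^ m i\<close> times a holomorphic
  function. In the Leibniz formula every term contains a derivative of that power of order below
  \<open>m i\<close>, which vanishes at the centre.\<close>

lemma higher_deriv_below_zero_order:
  assumes L: "zeros_with_mult L d \<zeta> m" and i: "i \<in> {1..d}" and n: "n < m i"
    and f: "f holomorphic_on Cstar"
  shows "(deriv ^^ n) (\<lambda>z. laurent_eval L z * f z) (\<zeta> i) = 0"
proof -
  let ?w = "\<zeta> i" and ?g = "zor_poly (laurent_eval L) (\<zeta> i)"
  have w: "?w \<in> Cstar"
    using L i by (auto simp: zeros_with_mult_def zero_set_def bij_betw_def)
  have order: "zorder (laurent_eval L) ?w = int (m i)"
    using L i by (simp add: zeros_with_mult_def)
  \<comment> \<open>Finiteness of the zero set shows that \<open>L\<close> is not identically zero,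
    as the local factorization on a connected domain requires.\<close>
  have "finite (zero_set L)"
    using L bij_betw_finite by (auto simp: zeros_with_mult_def)
  moreover have "infinite Cstar"
    by (simp add: Cstar_def finite_compl infinite_UNIV_char_0)
  ultimately have "zero_set L \<noteq> Cstar"
    by auto
  then have nz: "\<exists>v\<in>Cstar. laurent_eval L v \<noteq> 0"
    by (auto simp: zero_set_def)
  have "connected Cstar"
    by (simp add: Cstar_def connected_punctured_universe)
  from zorder_exist_zero[OF laurent_eval_holomorphic open_Cstar this w nz]
  obtain r where r: "r > 0" "cball ?w r \<subseteq> Cstar" "?g holomorphic_on cball ?w r"
    and eq: "\<forall>v\<in>cball ?w r. laurent_eval L v = ?g v * (v - ?w) ^ m i \<and> ?g v \<noteq> 0"
    unfolding order by auto
  have ball: "ball ?w r \<subseteq> cball ?w r" "?w \<in> ball ?w r"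
    using r(1) by auto
  have gf: "(\<lambda>v. ?g v * f v) holomorphic_on ball ?w r"
    using r ball f by (intro holomorphic_intros) (blast intro: holomorphic_on_subset)+
  have "(deriv ^^ n) (\<lambda>z. laurent_eval L z * f z) ?w
      = (deriv ^^ n) (\<lambda>v. (v - ?w) ^ m i * (?g v * f v)) ?w"
  proof (rule higher_deriv_cong_ev[OF _ refl])
    have "\<forall>\<^sub>F v in nhds ?w. v \<in> ball ?w r"
      using r(1) by (intro eventually_nhds_in_open) auto
    then show "\<forall>\<^sub>F v in nhds ?w. laurent_eval L v * f v = (v - ?w) ^ m i * (?g v * f v)"
      by eventually_elim (use eq in auto)
  qed
  also have "\<dots> = (\<Sum>k = 0..n. of_nat (n choose k) * (deriv ^^ k) (\<lambda>v. (v - ?w) ^ m i) ?w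
      * (deriv ^^ (n - k)) (\<lambda>v. ?g v * f v) ?w)"
    by (rule higher_deriv_mult[OF _ gf _ ball(2)]) (auto intro!: holomorphic_intros)
  also have "\<dots> = 0"
    using n by (intro sum.neutral) (auto simp: higher_deriv_power)
  finally show ?thesis .
qed

text \<open>The sum is the \<open>n\<close>-th derivative at the zero of \<open>L\<close> times the
  \<open>k\<close>-th CMV function. This is why the point masses disappear.\<close>

lemma mass_sum_zero:
  assumes "laurent_span L Np Nm" "zeros_with_mult L d \<zeta> m" "i \<in> {1..d}" "n < m i"
  shows "(\<Sum>j\<le>k + 2 * max Np Nm. laurent_Upsilon L k j * (deriv ^^ n) (cmv j) (\<zeta> i)) = 0"
proof -
  have w: "\<zeta> i \<in> Cstar"
    using assms(2,3) by (auto simp: zeros_with_mult_def zero_set_def bij_betw_def)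
  have "(\<Sum>j\<le>k + 2 * max Np Nm. laurent_Upsilon L k j * (deriv ^^ n) (cmv j) (\<zeta> i))
      = (deriv ^^ n) (\<lambda>z. \<Sum>j\<le>k + 2 * max Np Nm. laurent_Upsilon L k j * cmv j z) (\<zeta> i)"
    by (rule higher_deriv_cmult_sum[OF _ open_Cstar w, symmetric]) (auto intro: cmv_holomorphic)
  \<comment> \<open>The two functions are known to agree off the origin; agreement near the zero is
    enough for the derivatives.\<close>
  also have "\<dots> = (deriv ^^ n) (\<lambda>z. laurent_eval L z * cmv k z) (\<zeta> i)"
  proof (rule higher_deriv_cong_ev[OF _ refl])
    have "\<forall>\<^sub>F z in nhds (\<zeta> i). z \<in> Cstar"
      using w by (intro eventually_nhds_in_open open_Cstar)
    then show "\<forall>\<^sub>F z in nhds (\<zeta> i). (\<Sum>j\<le>k + 2 * max Np Nm. laurent_Upsilon L k j * cmv j z)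
        = laurent_eval L z * cmv k z"
      by eventually_elim (simp add: laurent_eval_cmv_sum[OF assms(1)])
  qed
  also have "\<dots> = 0"
    by (rule higher_deriv_below_zero_order[OF assms(2-4) cmv_holomorphic])
  finally show ?thesis .
qed

section \<open>Gram matrices of the perturbed forms\<close>

lemma smat_mult_dagger_row_banded:
  assumes "row_banded b B" "r + b \<le> n"
  shows "(A \<star>\<^sub>s smat_dagger B) k r = (\<Sum>j\<le>n. A k j * cnj (B r j))"
proof -
  have "(A \<star>\<^sub>s smat_dagger B) k r = smat_dagger (B \<star>\<^sub>s smat_dagger A) k r"
    by (simp add: smat_dagger_mult)
  then show ?thesis
    by (simp add: smat_dagger_def smat_mult_row_banded[OF assms] mult.commute)
qed

lemma open_nonzero_set: "open {z \<in> Cstar. laurent_eval L z \<noteq> 0}"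
  using continuous_open_preimage[OF holomorphic_on_imp_continuous_on[OF laurent_eval_holomorphic]
      open_Cstar, of "- {0}" L]
  by (simp add: vimage_def Int_def open_Compl)

context fundamental_functions
begin

lemma laurent_tensor_admissible:
  assumes "f \<in> laurent_functions" "g \<in> laurent_functions"
  shows "admissible Cstar2 (topspace T2) u (tensor_cnj f g)"
proof -
  have "tensor_cnj f g \<in> topspace T2"
    using assms laurent_strict_subset by (intro tensor_closed) auto
  then show ?thesis
    unfolding admissible_def agree_near_def by blast
qed

text \<open>Entry \<open>(k, r)\<close> of either side is the pairing under \<open>u\<close> of the
  \<open>k\<close>-th CMV function with \<open>M\<close> times the \<open>r\<close>-th one.\<close>

lemma gram_form12:
  assumes u: "u \<in> continuous_functionals Cstar2 T2"
    and L: "laurent_span L Np Nm" and M: "laurent_span M Np' Nm'"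
    and disj: "zero_set L \<inter> supp1 T2 u = {}" and zeros: "zeros_with_mult L d \<zeta> m"
  shows "laurent_Upsilon L \<star>\<^sub>s gram (form12 T2 u L M d \<zeta> m \<xi>)
    = gram (sesq_form T2 u) \<star>\<^sub>s smat_dagger (laurent_Upsilon M)"
proof (intro ext)
  fix k r
  define n where "n = k + 2 * max Np Nm"
  define n' where "n' = r + 2 * max Np' Nm'"
  let ?A = "laurent_Upsilon L" and ?B = "laurent_Upsilon M"
  let ?F = "topspace T2"
  let ?Mr = "\<lambda>z. laurent_eval M z * cmv r z"
  \<comment> \<open>An open set on which division by \<open>L\<close> in the first variable is
    legitimate; it contains the support by \<open>disj\<close>.\<close>
  let ?V = "{z \<in> Cstar. laurent_eval L z \<noteq> 0} \<times> UNIV"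
  \<comment> \<open>The values of \<open>\<xi>\<close> on \<open>?Mr\<close> do not depend on
    \<open>j\<close>, so the sum over \<open>j\<close> acts on the derivatives alone.\<close>
  have masses: "(\<Sum>j\<le>n. ?A k j * (\<Sum>i = 1..d. \<Sum>l<m i. 1 / fact l * (deriv ^^ l) (cmv j) (\<zeta> i)
      * cnj (\<xi> i l ?Mr))) = 0"
  proof -
    have "(\<Sum>j\<le>n. ?A k j * (\<Sum>i = 1..d. \<Sum>l<m i. 1 / fact l * (deriv ^^ l) (cmv j) (\<zeta> i)
        * cnj (\<xi> i l ?Mr)))
      = (\<Sum>j\<le>n. \<Sum>i = 1..d. \<Sum>l<m i. (?A k j * (deriv ^^ l) (cmv j) (\<zeta> i))
        * (1 / fact l * cnj (\<xi> i l ?Mr)))"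
      by (simp add: sum_distrib_left mult_ac)
    also have "\<dots> = (\<Sum>i = 1..d. \<Sum>l<m i. (\<Sum>j\<le>n. ?A k j * (deriv ^^ l) (cmv j) (\<zeta> i))
        * (1 / fact l * cnj (\<xi> i l ?Mr)))"
      unfolding sum_distrib_right
      by (subst sum.swap) (intro sum.cong refl sum.swap)
    also have "\<dots> = 0"
      by (intro sum.neutral ballI) (simp add: n_def mass_sum_zero[OF L zeros])
    finally show ?thesis .
  qed
  have "(\<Sum>j\<le>n. ?A k j * eval_functional Cstar2 ?F u (tensor_cnj (\<lambda>z. cmv j z / laurent_eval L z) ?Mr))
      = (\<Sum>j\<le>n'. cnj (?B r j) * eval_functional Cstar2 ?F u (tensor_cnj (cmv k) (cmv j)))"
  proof (rule eval_functional_sum_eq[where V = ?V])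
    show "function_space Cstar2 ?F" "has_support Cstar2 ?F u"
      using function_space2 support2[OF u] by auto
    show "linear_functional Cstar2 ?F u"
      using u by (simp add: continuous_functionals_def)
    show "open ?V"
      by (intro open_Times open_nonzero_set open_UNIV)
    show "supp Cstar2 ?F u \<subseteq> ?V"
    proof
      fix x assume x: "x \<in> supp Cstar2 ?F u"
      then have "fst x \<in> supp1 T2 u" "fst x \<in> Cstar"
        by (auto simp: supp_def)
      with disj have "laurent_eval L (fst x) \<noteq> 0"
        by (auto simp: zero_set_def)
      with \<open>fst x \<in> Cstar\<close> show "x \<in> ?V"
        by (cases x) auto
    qed
    show "admissible Cstar2 ?F u (tensor_cnj (\<lambda>z. cmv j z / laurent_eval L z) ?Mr)" for j
      by (rule local_evaluation1[OF u disj laurent_functions_cmv laurent_functions_mult_cmv[OF M]])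
    show "admissible Cstar2 ?F u (tensor_cnj (cmv k) (cmv j))" for j
      by (intro laurent_tensor_admissible laurent_functions_cmv)
    show "(\<Sum>j\<le>n. ?A k j * tensor_cnj (\<lambda>z. cmv j z / laurent_eval L z) ?Mr x)
        = (\<Sum>j\<le>n'. cnj (?B r j) * tensor_cnj (cmv k) (cmv j) x)" if "x \<in> ?V \<inter> Cstar2" for x
    proof -
      obtain z1 z2 where x: "x = (z1, z2)" "z1 \<noteq> 0" "z2 \<noteq> 0" "laurent_eval L z1 \<noteq> 0"
        using \<open>x \<in> ?V \<inter> Cstar2\<close> by (cases x) auto
      have "(\<Sum>j\<le>n. ?A k j * tensor_cnj (\<lambda>z. cmv j z / laurent_eval L z) ?Mr x)
          = (\<Sum>j\<le>n. ?A k j * cmv j z1) / laurent_eval L z1 * cnj (?Mr z2)"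
        by (simp add: x(1) tensor_cnj_def sum_distrib_right sum_divide_distrib mult.assoc)
      also have "\<dots> = cmv k z1 * cnj (\<Sum>j\<le>n'. ?B r j * cmv j z2)"
        using x(4) by (simp only: n_def n'_def laurent_eval_cmv_sum[OF L x(2), symmetric]
            laurent_eval_cmv_sum[OF M x(3), symmetric]) simp
      also have "\<dots> = (\<Sum>j\<le>n'. cnj (?B r j) * tensor_cnj (cmv k) (cmv j) x)"
        by (simp add: x(1) tensor_cnj_def sum_distrib_left mult_ac)
      finally show ?thesis .
    qed
  qed auto
  with masses have "(\<Sum>j\<le>n. ?A k j * gram (form12 T2 u L M d \<zeta> m \<xi>) j r)
      = (\<Sum>j\<le>n'. gram (sesq_form T2 u) k j * cnj (?B r j))"
    by (simp add: gram_def form12_def sesq_form_def distrib_left sum.distrib mult.commute)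
  then show "(?A \<star>\<^sub>s gram (form12 T2 u L M d \<zeta> m \<xi>)) k r
      = (gram (sesq_form T2 u) \<star>\<^sub>s smat_dagger ?B) k r"
    by (simp add: smat_mult_row_banded[OF row_banded_laurent_Upsilon[OF L], of k n]
        smat_mult_dagger_row_banded[OF row_banded_laurent_Upsilon[OF M], of r n'] n_def n'_def)
qed

text \<open>Here \<open>L\<close> divides the second, conjugated variable, so its matrix enters
  daggered and from the right. Entry \<open>(r, k)\<close> of either side pairs \<open>M\<close>
  times the \<open>r\<close>-th CMV function with the \<open>k\<close>-th one.\<close>

lemma gram_form21:
  assumes u: "u \<in> continuous_functionals Cstar2 T2"
    and L: "laurent_span L Np Nm" and M: "laurent_span M Np' Nm'"
    and disj: "zero_set L \<inter> supp2 T2 u = {}" and zeros: "zeros_with_mult L d \<zeta> m"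
  shows "gram (form21 T2 u L M d \<zeta> m \<xi>) \<star>\<^sub>s smat_dagger (laurent_Upsilon L)
    = laurent_Upsilon M \<star>\<^sub>s gram (sesq_form T2 u)"
proof (intro ext)
  fix r k
  define n where "n = k + 2 * max Np Nm"
  define n' where "n' = r + 2 * max Np' Nm'"
  let ?A = "laurent_Upsilon L" and ?B = "laurent_Upsilon M"
  let ?F = "topspace T2"
  let ?Mr = "\<lambda>z. laurent_eval M z * cmv r z"
  let ?V = "UNIV \<times> {z \<in> Cstar. laurent_eval L z \<noteq> 0}"
  have masses: "(\<Sum>j\<le>n. cnj (?A k j) * (\<Sum>i = 1..d. \<Sum>l<m i. 1 / fact l * \<xi> i l ?Mr
      * cnj ((deriv ^^ l) (cmv j) (\<zeta> i)))) = 0"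
  proof -
    have "(\<Sum>j\<le>n. cnj (?A k j) * (\<Sum>i = 1..d. \<Sum>l<m i. 1 / fact l * \<xi> i l ?Mr
        * cnj ((deriv ^^ l) (cmv j) (\<zeta> i))))
      = (\<Sum>j\<le>n. \<Sum>i = 1..d. \<Sum>l<m i. cnj (?A k j * (deriv ^^ l) (cmv j) (\<zeta> i))
        * (1 / fact l * \<xi> i l ?Mr))"
      by (simp add: sum_distrib_left mult_ac)
    also have "\<dots> = (\<Sum>i = 1..d. \<Sum>l<m i. cnj (\<Sum>j\<le>n. ?A k j * (deriv ^^ l) (cmv j) (\<zeta> i))
        * (1 / fact l * \<xi> i l ?Mr))"
      unfolding cnj_sum sum_distrib_right
      by (subst sum.swap) (intro sum.cong refl sum.swap)
    also have "\<dots> = 0"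
      by (intro sum.neutral ballI) (simp only: n_def mass_sum_zero[OF L zeros] lessThan_iff
          complex_cnj_zero mult_zero_left)
    finally show ?thesis .
  qed
  have "(\<Sum>j\<le>n. cnj (?A k j)
        * eval_functional Cstar2 ?F u (tensor_cnj ?Mr (\<lambda>z. cmv j z / laurent_eval L z)))
      = (\<Sum>j\<le>n'. ?B r j * eval_functional Cstar2 ?F u (tensor_cnj (cmv j) (cmv k)))"
  proof (rule eval_functional_sum_eq[where V = ?V])
    show "function_space Cstar2 ?F" "has_support Cstar2 ?F u"
      using function_space2 support2[OF u] by auto
    show "linear_functional Cstar2 ?F u"
      using u by (simp add: continuous_functionals_def)
    show "open ?V"
      by (intro open_Times open_nonzero_set open_UNIV)
    show "supp Cstar2 ?F u \<subseteq> ?V"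
    proof
      fix x assume x: "x \<in> supp Cstar2 ?F u"
      then have "snd x \<in> supp2 T2 u" "snd x \<in> Cstar"
        by (auto simp: supp_def)
      with disj have "laurent_eval L (snd x) \<noteq> 0"
        by (auto simp: zero_set_def)
      with \<open>snd x \<in> Cstar\<close> show "x \<in> ?V"
        by (cases x) auto
    qed
    show "admissible Cstar2 ?F u (tensor_cnj ?Mr (\<lambda>z. cmv j z / laurent_eval L z))" for j
      by (rule local_evaluation2[OF u disj laurent_functions_mult_cmv[OF M] laurent_functions_cmv])
    show "admissible Cstar2 ?F u (tensor_cnj (cmv j) (cmv k))" for j
      by (intro laurent_tensor_admissible laurent_functions_cmv)
    show "(\<Sum>j\<le>n. cnj (?A k j) * tensor_cnj ?Mr (\<lambda>z. cmv j z / laurent_eval L z) x)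
        = (\<Sum>j\<le>n'. ?B r j * tensor_cnj (cmv j) (cmv k) x)" if "x \<in> ?V \<inter> Cstar2" for x
    proof -
      obtain z1 z2 where x: "x = (z1, z2)" "z1 \<noteq> 0" "z2 \<noteq> 0" "laurent_eval L z2 \<noteq> 0"
        using \<open>x \<in> ?V \<inter> Cstar2\<close> by (cases x) auto
      have "(\<Sum>j\<le>n. cnj (?A k j) * tensor_cnj ?Mr (\<lambda>z. cmv j z / laurent_eval L z) x)
          = ?Mr z1 * cnj ((\<Sum>j\<le>n. ?A k j * cmv j z2) / laurent_eval L z2)"
        by (simp add: x(1) tensor_cnj_def sum_distrib_left sum_divide_distrib mult_ac)
      also have "\<dots> = (\<Sum>j\<le>n'. ?B r j * cmv j z1) * cnj (cmv k z2)"
        using x(4) by (simp only: n_def n'_def laurent_eval_cmv_sum[OF L x(3), symmetric]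
            laurent_eval_cmv_sum[OF M x(2), symmetric]) simp
      also have "\<dots> = (\<Sum>j\<le>n'. ?B r j * tensor_cnj (cmv j) (cmv k) x)"
        by (simp add: x(1) tensor_cnj_def sum_distrib_right mult.assoc)
      finally show ?thesis .
    qed
  qed auto
  with masses have "(\<Sum>j\<le>n. gram (form21 T2 u L M d \<zeta> m \<xi>) r j * cnj (?A k j))
      = (\<Sum>j\<le>n'. ?B r j * gram (sesq_form T2 u) j k)"
    by (simp add: gram_def form21_def sesq_form_def distrib_left sum.distrib
        mult.commute[of _ "cnj (laurent_Upsilon L _ _)"])
  then show "(gram (form21 T2 u L M d \<zeta> m \<xi>) \<star>\<^sub>s smat_dagger ?A) r k
      = (?B \<star>\<^sub>s gram (sesq_form T2 u)) r k"
    by (simp add: smat_mult_row_banded[OF row_banded_laurent_Upsilon[OF M], of r n']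
        smat_mult_dagger_row_banded[OF row_banded_laurent_Upsilon[OF L], of k n] n_def n'_def)
qed

end

theorem proposition12:
  fixes T1 :: "(complex \<Rightarrow> complex) topology"
    and T2 :: "(complex \<times> complex \<Rightarrow> complex) topology"
    and u :: "(complex \<times> complex \<Rightarrow> complex) \<Rightarrow> complex"
    and L\<Gamma>1 L\<Gamma>2 L\<CC>1 L\<CC>2 :: laurent
    and Np\<Gamma> Nm\<Gamma> Np\<CC> Nm\<CC> N\<Gamma> N\<CC> d1 d2 :: nat
    and \<zeta>1 \<zeta>2 :: "nat \<Rightarrow> complex"
    and m1 m2 :: "nat \<Rightarrow> nat"
    and \<xi>1 \<xi>2 :: "nat \<Rightarrow> nat \<Rightarrow> (complex \<Rightarrow> complex) \<Rightarrow> complex"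
    and S1 S2 S12_1 S12_2 S21_1 S21_2 :: smat
    and H H12 H21 :: "nat \<Rightarrow> complex"
    and l :: nat
    and z1 z2 :: complex
  defines "N\<Gamma> \<equiv> max Np\<Gamma> Nm\<Gamma>" and "N\<CC> \<equiv> max Np\<CC> Nm\<CC>"
  defines "G \<equiv> gram (sesq_form T2 u)"
    and "G12 \<equiv> gram (form12 T2 u L\<Gamma>1 L\<CC>2 d1 \<zeta>1 m1 \<xi>1)"
    and "G21 \<equiv> gram (form21 T2 u L\<Gamma>2 L\<CC>1 d2 \<zeta>2 m2 \<xi>2)"
  defines "\<Omega>12 \<equiv> connector S12_2 L\<CC>2 S2" and "\<Omega>21 \<equiv> connector S21_1 L\<CC>1 S1"
  assumes fundamental: "fundamental_functions T1 T2"
    and functional: "u \<in> continuous_functionals Cstar2 T2"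
    and degrees: "Np\<Gamma> \<ge> 1" "Nm\<Gamma> \<ge> 1" "Np\<CC> \<ge> 1" "Nm\<CC> \<ge> 1"
    and span\<Gamma>: "laurent_span L\<Gamma>1 Np\<Gamma> Nm\<Gamma>" "laurent_span L\<Gamma>2 Np\<Gamma> Nm\<Gamma>"
    and span\<CC>: "laurent_span L\<CC>1 Np\<CC> Nm\<CC>" "laurent_span L\<CC>2 Np\<CC> Nm\<CC>"
    and disjoint: "zero_set L\<Gamma>1 \<inter> supp1 T2 u = {}" "zero_set L\<Gamma>2 \<inter> supp2 T2 u = {}"
    and zeros: "zeros_with_mult L\<Gamma>1 d1 \<zeta>1 m1" "zeros_with_mult L\<Gamma>2 d2 \<zeta>2 m2"
    and masses1: "\<And>i k. \<lbrakk>i \<in> {1..d1}; k < m1 i\<rbrakk> \<Longrightarrow> linear_functional Cstar (topspace T1) (\<xi>1 i k)"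
    and masses2: "\<And>i k. \<lbrakk>i \<in> {1..d2}; k < m2 i\<rbrakk> \<Longrightarrow> linear_functional Cstar (topspace T1) (\<xi>2 i k)"
    and quasidef: "quasidefinite G" "quasidefinite G12" "quasidefinite G21"
    and factorization: "gauss_borel G S1 H S2"
    and factorization12: "gauss_borel G12 S12_1 H12 S12_2"
    and factorization21: "gauss_borel G21 S21_1 H21 S21_2"
    and l_ge: "l \<ge> 2 * max N\<CC> N\<Gamma>"
    and z: "z1 \<in> Cstar" "z2 \<in> Cstar"
  shows
    "(cnj (laurent_eval L\<CC>2 z1) * cd_kernel S12_1 H12 S12_2 l z1 z2
       - laurent_eval L\<Gamma>1 z2 * cd_kernel S1 H S2 l z1 z2
     = Matrix.vec (2 * N\<CC> + 2 * N\<Gamma>) (\<lambda>i. phi S12_1 (l - 2 * N\<CC> + i) z2 / H12 (l - 2 * N\<CC> + i))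
       \<bullet> (four_block_mat
             (0\<^sub>m (2 * N\<CC>) (2 * N\<Gamma>))             (map_mat cnj (C_block \<Omega>12 N\<CC> l))
             (- map_mat cnj (Gamma_block \<Omega>12 N\<Gamma> l))  (0\<^sub>m (2 * N\<Gamma>) (2 * N\<CC>))
           *\<^sub>v Matrix.vec (2 * N\<Gamma> + 2 * N\<CC>) (\<lambda>j. cnj (phi S2 (l - 2 * N\<Gamma> + j) z1))))
     \<and>
     (laurent_eval L\<CC>1 z2 * cd_kernel S21_1 H21 S21_2 l z1 z2
       - cnj (laurent_eval L\<Gamma>2 z1) * cd_kernel S1 H S2 l z1 z2
     = Matrix.vec (2 * N\<CC> + 2 * N\<Gamma>) (\<lambda>i. cnj (phi S21_2 (l - 2 * N\<CC> + i) z1) / H21 (l - 2 * N\<CC> + i))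
       \<bullet> (four_block_mat
             (0\<^sub>m (2 * N\<CC>) (2 * N\<Gamma>))   (C_block \<Omega>21 N\<CC> l)
             (- Gamma_block \<Omega>21 N\<Gamma> l)       (0\<^sub>m (2 * N\<Gamma>) (2 * N\<CC>))
           *\<^sub>v Matrix.vec (2 * N\<Gamma> + 2 * N\<CC>) (\<lambda>j. phi S1 (l - 2 * N\<Gamma> + j) z2)))"
proof -
  interpret fundamental_functions T1 T2
    by (rule fundamental)
  have l: "2 * N\<Gamma> \<le> l" "2 * N\<CC> \<le> l"
    using l_ge by auto
  have z': "z1 \<noteq> 0" "z2 \<noteq> 0"
    using z by auto
  have "laurent_Upsilon L\<Gamma>1 \<star>\<^sub>s G12 = G \<star>\<^sub>s smat_dagger (laurent_Upsilon L\<CC>2)"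
    unfolding G12_def G_def
    by (rule gram_form12[OF functional span\<Gamma>(1) span\<CC>(2) disjoint(1) zeros(1)])
  note connection12 = cd_kernel_connection[OF factorization factorization12 span\<Gamma>(1) span\<CC>(2) this,
      folded N\<Gamma>_def N\<CC>_def \<Omega>12_def, OF refl l(1) refl l(2) z']
  \<comment> \<open>Taking daggers brings the (2,1) relation into the shape of
    \<open>gram_relation\<close>, with conjugate transposed Gram matrices.\<close>
  have "smat_dagger (laurent_Upsilon L\<CC>1 \<star>\<^sub>s G)
      = smat_dagger (G21 \<star>\<^sub>s smat_dagger (laurent_Upsilon L\<Gamma>2))"
    unfolding G21_def G_def
    by (simp only: gram_form21[OF functional span\<Gamma>(2) span\<CC>(1) disjoint(2) zeros(2)])
  then have "laurent_Upsilon L\<Gamma>2 \<star>\<^sub>s smat_dagger G21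
      = smat_dagger G \<star>\<^sub>s smat_dagger (laurent_Upsilon L\<CC>1)"
    by (simp add: smat_dagger_mult)
  note connection21 = cd_kernel_connection[OF gauss_borel_dagger[OF factorization]
      gauss_borel_dagger[OF factorization21] span\<Gamma>(2) span\<CC>(1) this,
      folded N\<Gamma>_def N\<CC>_def \<Omega>21_def, OF refl l(1) refl l(2) z'(2,1)]
  show ?thesis
  proof
    \<comment> \<open>By \<open>l\<close>, the natural number
      \<open>l - 2 * N\<CC> + (2 * N\<CC> + i)\<close> is \<open>l + i\<close>, and likewise for
      \<open>N\<Gamma>\<close>, which matches the corner indices.\<close>
    show "cnj (laurent_eval L\<CC>2 z1) * cd_kernel S12_1 H12 S12_2 l z1 z2
       - laurent_eval L\<Gamma>1 z2 * cd_kernel S1 H S2 l z1 z2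
     = Matrix.vec (2 * N\<CC> + 2 * N\<Gamma>) (\<lambda>i. phi S12_1 (l - 2 * N\<CC> + i) z2 / H12 (l - 2 * N\<CC> + i))
       \<bullet> (four_block_mat
             (0\<^sub>m (2 * N\<CC>) (2 * N\<Gamma>))             (map_mat cnj (C_block \<Omega>12 N\<CC> l))
             (- map_mat cnj (Gamma_block \<Omega>12 N\<Gamma> l))  (0\<^sub>m (2 * N\<Gamma>) (2 * N\<CC>))
           *\<^sub>v Matrix.vec (2 * N\<Gamma> + 2 * N\<CC>) (\<lambda>j. cnj (phi S2 (l - 2 * N\<Gamma> + j) z1)))"
      by (subst antidiagonal_block_form) (use l in \<open>simp_all add: C_block_def Gamma_block_def
          connection12 add.assoc[symmetric]\<close>)
    \<comment> \<open>Conjugating the kernels of the daggered problem at \<open>(z2, z1)\<close>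
      returns the original kernels at \<open>(z1, z2)\<close>.\<close>
    have "laurent_eval L\<CC>1 z2 * cd_kernel S21_1 H21 S21_2 l z1 z2
       - cnj (laurent_eval L\<Gamma>2 z1) * cd_kernel S1 H S2 l z1 z2
      = cnj (cnj (laurent_eval L\<CC>1 z2) * cd_kernel S21_2 (\<lambda>k. cnj (H21 k)) S21_1 l z2 z1
       - laurent_eval L\<Gamma>2 z1 * cd_kernel S2 (\<lambda>k. cnj (H k)) S1 l z2 z1)"
      by (simp add: cnj_cd_kernel)
    then show "laurent_eval L\<CC>1 z2 * cd_kernel S21_1 H21 S21_2 l z1 z2
       - cnj (laurent_eval L\<Gamma>2 z1) * cd_kernel S1 H S2 l z1 z2
     = Matrix.vec (2 * N\<CC> + 2 * N\<Gamma>) (\<lambda>i. cnj (phi S21_2 (l - 2 * N\<CC> + i) z1) / H21 (l - 2 * N\<CC> + i))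
       \<bullet> (four_block_mat
             (0\<^sub>m (2 * N\<CC>) (2 * N\<Gamma>))   (C_block \<Omega>21 N\<CC> l)
             (- Gamma_block \<Omega>21 N\<Gamma> l)       (0\<^sub>m (2 * N\<Gamma>) (2 * N\<CC>))
           *\<^sub>v Matrix.vec (2 * N\<Gamma> + 2 * N\<CC>) (\<lambda>j. phi S1 (l - 2 * N\<Gamma> + j) z2))"
      unfolding connection21
      by (subst antidiagonal_block_form) (use l in \<open>simp_all add: C_block_def Gamma_block_def
          add.assoc[symmetric]\<close>)
  qed
qed

end
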